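(* Let $A\in\mathbb{R}^{n\times n}$, $B_1^{\rm o}\in\mathbb{R}^{n\times m_1}$, $B_2\in\mathbb{R}^{n\times m_2}$, $C_1^{\rm o}\in\mathbb{R}^{p_1\times n}$, $C_2\in\mathbb{R}^{p_2\times n}$ be (constant) real matrices. Define the projected channels $$\widetilde B_1=B_2B_2^{\dagger}B_1^{\rm o},\qquad \widetilde C_1=C_1^{\rm o}C_2^{\dagger}C_2,$$ and $$\gamma^*=\max\{\|B_2^{\dagger}B_1^{\rm o}\|_2,\ \|C_1^{\rm o}C_2^{\dagger}\|_2\}.$$ Suppose that $\gamma>\gamma^*>0$, that $(A,B_2)$ and $(A,\widetilde B_1)$ are stabilizable, and that $(\widetilde C_1,A)$ and $(C_2,A)$ are detectable. Set $$G_\gamma=B_2B_2^{\top}-\gamma^{-2}\widetilde B_1\widetilde B_1^{\top},\qquad H_\gamma=C_2^{\top}C_2-\gamma^{-2}\widetilde C_1^{\top}\widetilde C_1 .$$ Then the Hamiltonian matrices $$H_\infty(\gamma)=\begin{bmatrix}A&-G_\gamma\\ -\widetilde C_1^{\top}\widetilde C_1&-A^{\top}\end{bmatrix},\qquad J_\infty(\gamma)=\begin{bmatrix}A^{\top}&-H_\gamma\\ -\widetilde B_1\widetilde B_1^{\top}&-A\end{bmatrix}$$ both belong to $\operatorname{Dom}(\operatorname{Ric})$, and the corresponding stabilizing solutions $X(\gamma)=\operatorname{Ric}(H_\infty(\gamma))$ and $Y(\gamma)=\operatorname{Ric}(J_\infty(\gamma))$ satisfy $X(\gamma)=X(\gamma)^{\top}\ge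 0$ and $Y(\gamma)=Y(\gamma)^{\top}\ge 0$. (Here $X(\gamma)$ solves $A^{\top}X+XA-XG_\gamma X+\widetilde C_1^{\top}\widetilde C_1=0$ with $A-G_\gamma X$ stable, and $Y(\gamma)$ solves $AY+YA^{\top}-YH_\gamma Y+\widetilde B_1\widetilde B_1^{\top}=0$ with $A^{\top}-H_\gamma Y$ stable.)
   Context: $M^{\dagger}$ denotes the Moore--Penrose inverse and $\|\cdot\|_2$ the spectral norm. A real square matrix is called stable if all its eigenvalues have negative real part. $(A,B)$ is stabilizable if $A+BK$ is stable for some real matrix $K$; $(C,A)$ is detectable if $(A^{\top},C^{\top})$ is stabilizable. For symmetric matrices, $\ge 0$ means positive semidefinite. Riccati domain: let $H=\begin{bmatrix}F&-R\\ -Q&-F^{\top}\end{bmatrix}\in\mathbb{R}^{2r\times 2r}$ with $F,R,Q\in\mathbb{R}^{r\times r}$, $R=R^{\top}$, $Q=Q^{\top}$ (a Hamiltonian matrix). One writes $H\in\operatorname{Dom}(\operatorname{Ric})$ if and only if $H$ has no eigenvalues on the imaginary axis and its $r$-dimensional stable invariant subspace (the invariant subspace belonging to the eigenvalues with negative real part) has a basis given by the columns of the $2r\times r$ matrix $[U_1^{\top},U_2^{\top}]^{\top}$ ($U_1$ stacked on top of $U_2$), $U_1,U_2\in\mathbb{R}^{r\times r}$, with $U_1$ nonsingular. In that case $\operatorname{Ric}(H):=U_2U_1^{-1}$, which does not depend on the chosen basis; it is the unique symmetric solution $P$ of $F^{\top}P+PF-PRP+Q=0$ for which $F-RP$ is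 stable (the stabilizing solution). *)

theory Defs
  imports "HOL-Analysis.Analysis"
begin

text \<open>
  \<open>real^'n^'m\<close> is the type of real matrices with \<open>CARD('m)\<close> rows and \<open>CARD('n)\<close> columns; an
  index of the sum type \<open>'a + 'b\<close> addresses the two blocks of a partitioned matrix.
\<close>

subsection \<open>Moore--Penrose inverse and spectral norm\<close>

definition penrose_inverse :: "real^'n^'m \<Rightarrow> real^'m^'n \<Rightarrow> bool" where
  "penrose_inverse M X \<longleftrightarrow>
     M ** X ** M = M \<and> X ** M ** X = X \<and>
     transpose (M ** X) = M ** X \<and> transpose (X ** M) = X ** M"

definition pinv :: "real^'n^'m \<Rightarrow> real^'m^'n" where
  "pinv M = (THE X. penrose_inverse M X)"

definition spectral_norm :: "real^'n^'m \<Rightarrow> real" where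
  "spectral_norm M = onorm ((*v) M)"

definition pos_semidef :: "real^'n^'n \<Rightarrow> bool" where
  "pos_semidef M \<longleftrightarrow> transpose M = M \<and> (\<forall>x. 0 \<le> x \<bullet> (M *v x))"

subsection \<open>Complex eigenvalues of real matrices, stability\<close>

abbreviation complex_matrix :: "real^'n^'m \<Rightarrow> complex^'n^'m" where
  "complex_matrix \<equiv> map_matrix complex_of_real"

abbreviation complex_vector :: "real^'n \<Rightarrow> complex^'n" where
  "complex_vector x \<equiv> (\<chi> i. complex_of_real (x $ i))"

definition eigenvalue :: "real^'n^'n \<Rightarrow> complex \<Rightarrow> bool" where
  "eigenvalue M \<mu> \<longleftrightarrow> (\<exists>v. v \<noteq> 0 \<and> complex_matrix M *v v = \<mu> *s v)"

definition stable :: "real^'n^'n \<Rightarrow> bool" where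
  "stable M \<longleftrightarrow> (\<forall>\<mu>. eigenvalue M \<mu> \<longrightarrow> Re \<mu> < 0)"

definition stabilizable :: "real^'n^'n \<Rightarrow> real^'m^'n \<Rightarrow> bool" where
  "stabilizable A B \<longleftrightarrow> (\<exists>K. stable (A + B ** K))"

definition detectable :: "real^'n^'p \<Rightarrow> real^'n^'n \<Rightarrow> bool" where
  "detectable C A \<longleftrightarrow> stabilizable (transpose A) (transpose C)"

subsection \<open>The stable invariant subspace\<close>

definition generalized_eigenspace :: "real^'n^'n \<Rightarrow> complex \<Rightarrow> (complex^'n) set" where
  "generalized_eigenspace M \<mu> = {v. \<exists>k. (((*v) (complex_matrix M - mat \<mu>)) ^^ k) v = 0}"

text \<open>
  The complex invariant subspace belonging to the eigenvalues in the open left half-plane is the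
  sum of their generalized eigenspaces. It is closed under conjugation, so it is the
  complexification of the real subspace of its real vectors, which is the one defined here.
\<close>

definition stable_subspace :: "real^'n^'n \<Rightarrow> (real^'n) set" where
  "stable_subspace M =
     {x. complex_vector x \<in>
           vec.span (\<Union>\<mu>\<in>{\<mu>. eigenvalue M \<mu> \<and> Re \<mu> < 0}. generalized_eigenspace M \<mu>)}"

subsection \<open>The Riccati domain\<close>

definition block_matrix ::
  "real^'c^'a \<Rightarrow> real^'d^'a \<Rightarrow> real^'c^'b \<Rightarrow> real^'d^'b \<Rightarrow> real^('c + 'd)^('a + 'b)" where
  "block_matrix M11 M12 M21 M22 =
     (\<chi> i j. case (i, j) of
        (Inl a, Inl c) \<Rightarrow> M11 $ a $ c
      | (Inl a, Inr d) \<Rightarrow> M12 $ a $ d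
      | (Inr b, Inl c) \<Rightarrow> M21 $ b $ c
      | (Inr b, Inr d) \<Rightarrow> M22 $ b $ d)"

definition stack_matrix :: "real^'c^'a \<Rightarrow> real^'c^'b \<Rightarrow> real^'c^('a + 'b)" where
  "stack_matrix U1 U2 = (\<chi> i. case i of Inl a \<Rightarrow> U1 $ a | Inr b \<Rightarrow> U2 $ b)"

definition hamiltonian_matrix :: "real^('r::finite + 'r)^('r + 'r) \<Rightarrow> bool" where
  "hamiltonian_matrix H \<longleftrightarrow>
     (\<exists>F R Q. transpose R = R \<and> transpose Q = Q \<and>
        H = block_matrix F (- R) (- Q) (- transpose F))"

text \<open>Injectivity is needed because \<open>columns W\<close> is a set, which forgets repeated columns.\<close>

definition columns_basis :: "real^'k^'n \<Rightarrow> (real^'n) set \<Rightarrow> bool" where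
  "columns_basis W S \<longleftrightarrow>
     inj (\<lambda>j. column j W) \<and> independent (columns W) \<and> span (columns W) = S"

definition stable_basis ::
  "real^('r::finite + 'r)^('r + 'r) \<Rightarrow> real^'r^'r \<Rightarrow> real^'r^'r \<Rightarrow> bool" where
  "stable_basis H U1 U2 \<longleftrightarrow> columns_basis (stack_matrix U1 U2) (stable_subspace H)"

definition Dom_Ric :: "(real^('r::finite + 'r)^('r + 'r)) set" where
  "Dom_Ric = {H. hamiltonian_matrix H \<and>
     (\<forall>\<mu>. eigenvalue H \<mu> \<longrightarrow> Re \<mu> \<noteq> 0) \<and>
     (\<exists>U1 U2. stable_basis H U1 U2 \<and> invertible U1)}"

text \<open>The value does not depend on the choice of basis, hence the definite description.\<close>

definition Ric :: "real^('r::finite + 'r)^('r + 'r) \<Rightarrow> real^'r^'r" where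
  "Ric H = (THE P. \<exists>U1 U2. stable_basis H U1 U2 \<and> invertible U1 \<and> P = U2 ** matrix_inv U1)"

end

theory Submission
  imports Defs "HOL-Computational_Algebra.Fundamental_Theorem_Algebra"
begin

text \<open>
  The two claims are one claim for dual data, \<open>(A, B2, C1t)\<close> and
  \<open>(A\<^sup>T, C2\<^sup>T, B1t\<^sup>T)\<close>. The projections give \<open>B1t = B2 N\<close> with
  \<open>N = pinv B2 ** B1o\<close>, so that \<open>\<gamma> > \<parallel>N\<parallel>\<close> makes the weight \<open>G\<close> positive semidefinite, and
  definite on the range of \<open>B2\<close>: \<open>G \<ge> c B2 B2\<^sup>T\<close> with \<open>c = 1 - \<parallel>N\<parallel>\<^sup>2 / \<gamma>\<^sup>2 > 0\<close>
  (\<open>input_weight_coercive\<close>). What is left is the Riccati equation of the linear-quadratic regulator,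
  whose data are positive semidefinite, stabilizable and detectable.

  The stabilizing solution is found by minimization instead of an analysis of the spectrum of the
  Hamiltonian. Call a positive semidefinite \<open>P\<close> a subsolution if its Riccati residual
  \<open>A\<^sup>TP + PA - PGP + Q\<close> is negative semidefinite. Detectability makes \<open>A - GP\<close> stable for
  every subsolution (\<open>stable_if_riccati_nonpos\<close>), stabilizability and the bound on \<open>G\<close> provide one
  (\<open>riccati_subsolution_exists\<close>), and a Newton step turns a subsolution \<open>P\<close> into a
  subsolution \<open>P' \<le> P\<close> whose residual is \<open>-(P - P')G(P - P')\<close> (\<open>newton_step\<close>). The subsolutions of
  bounded trace form a compact set, so there is one of minimal trace; the Newton step cannot move it,
  hence its residual vanishes (\<open>stabilizing_riccati_solution_exists\<close>).

  Both the first subsolution and the Newton step come from Lyapunov equations with a stable matrix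
  \<open>M\<close>. Their solvability, as well as the passage to the Riccati domain, rests on one fact about
  generalized eigenspaces: if \<open>HZ = ZM\<close>, then \<open>Z\<close> maps those of \<open>M\<close> into those of \<open>H\<close>. Since the
  generalized eigenspaces of \<open>M\<close> span \<open>\<complex>\<^sup>n\<close>, such a \<open>Z\<close> vanishes if the spectra are disjoint,
  which gives unique solvability; and the graph of the stabilizing solution \<open>P\<close>, which intertwines
  \<open>A - GP\<close> with the Hamiltonian, is identified with the stable subspace
  (\<open>Dom_Ric_if_stabilizing_solution\<close>).
\<close>

section \<open>Matrix algebra\<close>

lemma matrix_mult_uminus_left: "(- X) ** Y = - (X ** (Y :: real^'n^'m))"
  by (simp add: vec_eq_iff matrix_matrix_mult_def sum_negf)

lemma matrix_mult_uminus_right: "X ** (- Y) = - (X ** (Y :: real^'n^'m))"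
  by (simp add: vec_eq_iff matrix_matrix_mult_def sum_negf)

lemma matrix_vector_mult_uminus: "(- X) *v x = - (X *v (x :: real^'n))"
  by (simp add: vec_eq_iff matrix_vector_mult_def sum_negf)

lemma matrix_add_rdistrib: "(X + Y) ** Z = X ** Z + Y ** (Z :: real^'n^'m)"
  by (simp add: vec_eq_iff matrix_matrix_mult_def sum.distrib algebra_simps)

lemma matrix_diff_ldistrib: "X ** (Y - Z) = X ** Y - X ** (Z :: real^'n^'m)"
  by (simp add: vec_eq_iff matrix_matrix_mult_def sum_subtractf algebra_simps)

lemma matrix_diff_rdistrib: "(X - Y) ** Z = X ** Z - Y ** (Z :: real^'n^'m)"
  by (simp add: vec_eq_iff matrix_matrix_mult_def sum_subtractf algebra_simps)

lemma transpose_add: "transpose (X + Y) = transpose X + transpose (Y :: real^'n^'m)"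
  by (simp add: vec_eq_iff transpose_def)

lemma transpose_diff: "transpose (X - Y) = transpose X - transpose (Y :: real^'n^'m)"
  by (simp add: vec_eq_iff transpose_def)

lemma transpose_uminus: "transpose (- X) = - transpose (X :: real^'n^'m)"
  by (simp add: vec_eq_iff transpose_def)

lemma matrix_mult_scaleR_left: "(c *\<^sub>R X) ** Y = c *\<^sub>R (X ** (Y :: real^'n^'m))"
  by (simp add: vec_eq_iff matrix_matrix_mult_def sum_distrib_left mult.assoc)

lemma matrix_mult_scaleR_right: "X ** (c *\<^sub>R Y) = c *\<^sub>R (X ** (Y :: real^'n^'m))"
  by (simp add: vec_eq_iff matrix_matrix_mult_def sum_distrib_left mult.left_commute)

lemmas matrix_ring_simps = matrix_mult_uminus_left matrix_mult_uminus_right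
  matrix_diff_ldistrib matrix_diff_rdistrib matrix_add_ldistrib matrix_add_rdistrib
  transpose_add transpose_diff transpose_uminus matrix_transpose_mul transpose_scalar
  matrix_mul_assoc

lemma inner_transpose_mult: "x \<bullet> (transpose A *v y) = (A *v x) \<bullet> (y :: real^'m)"
  using dot_lmul_matrix[of y A x] by (simp add: inner_commute)

lemma inner_symmetric_mult:
  fixes X :: "real^'n^'n"
  assumes "transpose X = X"
  shows "x \<bullet> (X *v y) = (X *v x) \<bullet> y"
  using inner_transpose_mult[of x X y] unfolding assms .

lemma inner_gram:
  fixes C :: "real^'n^'p"
  shows "x \<bullet> ((transpose C ** C) *v x) = (norm (C *v x))\<^sup>2"
  using inner_transpose_mult[of x C "C *v x"]
  by (simp only: matrix_vector_mul_assoc[symmetric] power2_norm_eq_inner)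

section \<open>Generalized eigenspaces\<close>

abbreviation shift :: "real^'n^'n \<Rightarrow> complex \<Rightarrow> complex^'n \<Rightarrow> complex^'n" where
  "shift M \<mu> v \<equiv> complex_matrix M *v v - \<mu> *s v"

lemma mat_mult_vector: "mat c *v v = c *s (v :: complex^'n)"
  by (simp add: vec_eq_iff matrix_vector_mult_def mat_def if_distrib if_distribR cong: if_cong)

lemma generalized_eigenspace_alt:
  "v \<in> generalized_eigenspace M \<mu> \<longleftrightarrow> (\<exists>k. (shift M \<mu> ^^ k) v = 0)"
proof -
  have "(*v) (complex_matrix M - mat \<mu>) = shift M \<mu>"
    by (simp add: fun_eq_iff matrix_vector_mult_diff_rdistrib mat_mult_vector)
  then show ?thesis by (simp add: generalized_eigenspace_def)
qed

lemma shift_zero [simp]: "shift M \<mu> 0 = 0"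
  by simp

lemma funpow_shift_zero [simp]: "(shift M \<mu> ^^ k) 0 = 0"
  by (induction k) auto

lemma shift_linear: "shift M \<mu> (c *s v + w) = c *s shift M \<mu> v + shift M \<mu> w"
  by (simp add: vec.add vec.scale algebra_simps vec.scale_right_diff_distrib mult.commute)

lemma funpow_shift_linear:
  "(shift M \<mu> ^^ k) (c *s v + w) = c *s (shift M \<mu> ^^ k) v + (shift M \<mu> ^^ k) w"
  by (induction k) (simp_all only: funpow_0 funpow.simps o_def id_def shift_linear)

lemma generalized_eigenspace_zero [simp]: "0 \<in> generalized_eigenspace M \<mu>"
  by (auto simp: generalized_eigenspace_alt)

lemma generalized_eigenspace_linear:
  assumes "v \<in> generalized_eigenspace M \<mu>" "w \<in> generalized_eigenspace M \<mu>"
  shows "c *s v + w \<in> generalized_eigenspace M \<mu>"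
proof -
  obtain k l where k: "(shift M \<mu> ^^ k) v = 0" and l: "(shift M \<mu> ^^ l) w = 0"
    using assms by (auto simp: generalized_eigenspace_alt)
  have "(shift M \<mu> ^^ (k + l)) v = 0"
    by (simp only: funpow_add add.commute[of k] o_def k funpow_shift_zero)
  moreover have "(shift M \<mu> ^^ (k + l)) w = 0"
    by (simp only: funpow_add o_def l funpow_shift_zero)
  ultimately show ?thesis
    unfolding generalized_eigenspace_alt
    by (intro exI[of _ "k + l"]) (simp only: funpow_shift_linear, simp)
qed

lemma generalized_eigenspace_scale:
  "v \<in> generalized_eigenspace M \<mu> \<Longrightarrow> c *s v \<in> generalized_eigenspace M \<mu>"
  using generalized_eigenspace_linear[of v M \<mu> 0 c] by simp

lemma generalized_eigenspace_if_shift: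
  assumes "shift M \<mu> v \<in> generalized_eigenspace M \<mu>"
  shows "v \<in> generalized_eigenspace M \<mu>"
proof -
  obtain k where "(shift M \<mu> ^^ k) (shift M \<mu> v) = 0"
    using assms by (auto simp: generalized_eigenspace_alt)
  then have "(shift M \<mu> ^^ Suc k) v = 0" by (simp only: funpow_Suc_right o_def)
  then show ?thesis unfolding generalized_eigenspace_alt by blast
qed

text \<open>
  Induction along the chain \<open>v, (M - \<mu>)v, (M - \<mu>)\<^sup>2 v, \<dots>\<close>, which ends in \<open>0\<close>. It
  spares the arguments below the nilpotency exponent.
\<close>

lemma generalized_eigenspace_induct [consumes 1, case_names zero shift]:
  assumes v: "v \<in> generalized_eigenspace M \<mu>"
    and zero: "P 0"
    and step: "\<And>v. shift M \<mu> v \<in> generalized_eigenspace M \<mu> \<Longrightarrow> P (shift M \<mu> v) \<Longrightarrow> P v"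
  shows "P v"
proof -
  obtain k where "(shift M \<mu> ^^ k) v = 0"
    using v by (auto simp: generalized_eigenspace_alt)
  then show ?thesis
  proof (induction k arbitrary: v)
    case 0
    then show ?case using zero by simp
  next
    case (Suc k)
    then have k: "(shift M \<mu> ^^ k) (shift M \<mu> v) = 0" by (simp only: funpow_Suc_right o_def)
    show ?case
      by (rule step) (use k Suc.IH in \<open>auto simp only: generalized_eigenspace_alt\<close>)
  qed
qed

lemma generalized_eigenspace_trivial:
  assumes "v \<in> generalized_eigenspace M \<mu>" and "\<not> eigenvalue M \<mu>"
  shows "v = 0"
  using assms(1)
proof (induction rule: generalized_eigenspace_induct)
  case (shift v)
  then have "complex_matrix M *v v = \<mu> *s v" by simp
  then show ?case using assms(2) by (auto simp: eigenvalue_def)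
qed simp

text \<open>
  On the generalized eigenspace of \<open>\<nu>\<close> the map \<open>M - \<mu> = (\<nu> - \<mu>) + (M - \<nu>)\<close> is a nonzero scalar
  plus a nilpotent map. Going along the chain of \<open>e\<close>, a preimage \<open>w\<close> of \<open>(M - \<nu>)e\<close> yields the
  preimage \<open>(e - w) / (\<nu> - \<mu>)\<close> of \<open>e\<close>.
\<close>

lemma shift_onto_generalized_eigenspace:
  assumes "e \<in> generalized_eigenspace M \<nu>" and "\<nu> \<noteq> \<mu>"
  shows "\<exists>w \<in> generalized_eigenspace M \<nu>. shift M \<mu> w = e"
  using assms(1)
proof (induction rule: generalized_eigenspace_induct)
  case zero
  show ?case by (intro bexI[of _ 0]) auto
next
  case (shift e)
  then obtain w where w: "w \<in> generalized_eigenspace M \<nu>" "shift M \<mu> w = shift M \<nu> e" by blast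
  have e: "e \<in> generalized_eigenspace M \<nu>"
    using shift(1) by (rule generalized_eigenspace_if_shift)
  define w' where "w' = (1 / (\<nu> - \<mu>)) *s ((-1) *s w + e)"
  have "w' \<in> generalized_eigenspace M \<nu>"
    unfolding w'_def by (intro generalized_eigenspace_scale generalized_eigenspace_linear w e)
  moreover have "shift M \<mu> w' = e"
  proof -
    have "shift M \<mu> ((-1) *s w + e) = (-1) *s shift M \<mu> w + shift M \<mu> e" by (rule shift_linear)
    also have "\<dots> = (\<nu> - \<mu>) *s e" unfolding w(2) by (simp add: vec_eq_iff algebra_simps)
    finally have e': "shift M \<mu> ((-1) *s w + e) = (\<nu> - \<mu>) *s e" .
    have "shift M \<mu> w' = (1 / (\<nu> - \<mu>)) *s shift M \<mu> ((-1) *s w + e)"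
      unfolding w'_def vec.scale by (simp add: vec_eq_iff algebra_simps diff_divide_distrib)
    then have "shift M \<mu> w' = (1 / (\<nu> - \<mu>)) *s ((\<nu> - \<mu>) *s e)" by (simp only: e')
    then show ?thesis using assms(2) by (simp only: vec.scale_scale) simp
  qed
  ultimately show ?case by blast
qed

definition poly_act :: "real^'n^'n \<Rightarrow> complex poly \<Rightarrow> complex^'n \<Rightarrow> complex^'n" where
  "poly_act M p v = (\<Sum>i\<le>degree p. coeff p i *s ((*v) (complex_matrix M) ^^ i) v)"

lemma poly_act_bound:
  assumes "degree p \<le> N"
  shows "poly_act M p v = (\<Sum>i\<le>N. coeff p i *s ((*v) (complex_matrix M) ^^ i) v)"
  unfolding poly_act_def
  by (rule sum.mono_neutral_left) (use assms in \<open>auto simp: coeff_eq_0\<close>)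

lemma poly_act_linear_factor:
  "poly_act M ([:-\<mu>, 1:] * q) v = poly_act M q (shift M \<mu> v)"
proof -
  let ?L = "(*v) (complex_matrix M)"
  let ?r = "degree q"
  have lin: "(?L ^^ i) (shift M \<mu> v) = (?L ^^ Suc i) v - \<mu> *s (?L ^^ i) v" for i
  proof (induction i)
    case (Suc i)
    then show ?case
      by (simp add: vec.diff vec.scale)
  qed simp
  have p: "[:-\<mu>, 1:] * q = pCons 0 q - smult \<mu> q" by simp
  have "degree ([:-\<mu>, 1:] * q) \<le> Suc ?r"
    using degree_mult_le[of "[:-\<mu>, 1:]" q] by simp
  then have "poly_act M ([:-\<mu>, 1:] * q) v
      = (\<Sum>i\<le>Suc ?r. coeff (pCons 0 q - smult \<mu> q) i *s (?L ^^ i) v)"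
    unfolding p by (rule poly_act_bound)
  also have "\<dots> = (\<Sum>i\<le>Suc ?r. coeff (pCons 0 q) i *s (?L ^^ i) v)
      - (\<Sum>i\<le>Suc ?r. (\<mu> * coeff q i) *s (?L ^^ i) v)"
    by (simp add: vec.scale_left_diff_distrib sum_subtractf del: sum.atMost_Suc)
  also have "(\<Sum>i\<le>Suc ?r. coeff (pCons 0 q) i *s (?L ^^ i) v)
      = (\<Sum>i\<le>?r. coeff q i *s (?L ^^ Suc i) v)"
    by (subst sum.atMost_Suc_shift) simp
  also have "(\<Sum>i\<le>Suc ?r. (\<mu> * coeff q i) *s (?L ^^ i) v)
      = (\<Sum>i\<le>?r. coeff q i *s (\<mu> *s (?L ^^ i) v))"
    by (simp add: coeff_eq_0 mult.commute)
  finally show ?thesis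
    unfolding poly_act_def lin
    by (simp add: vec.scale_right_diff_distrib sum_subtractf)
qed

text \<open>
  The \<open>n + 1\<close> vectors \<open>v, Mv, \<dots>, M\<^sup>n v\<close> are linearly dependent. Two of them may coincide,
  in which case the dependence is invisible in the set that they form, and \<open>x\<^sup>j - x\<^sup>i\<close> annihilates
  \<open>v\<close>.
\<close>

lemma annihilating_poly_exists:
  fixes M :: "real^'n^'n"
  shows "\<exists>p. p \<noteq> 0 \<and> poly_act M p v = 0"
proof -
  let ?L = "(*v) (complex_matrix M)"
  let ?n = "CARD('n)"
  let ?f = "\<lambda>i. (?L ^^ i) v"
  show ?thesis
  proof (cases "inj_on ?f {..?n}")
    case False
    then obtain i j where ij: "?f i = ?f j" "i < j" "j \<le> ?n"
      unfolding inj_on_def by (metis atMost_iff linorder_neqE_nat)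
    let ?p = "monom 1 j - monom 1 i :: complex poly"
    have "?p \<noteq> 0" using ij(2) by (simp add: poly_eq_iff) (metis less_irrefl zero_neq_one)
    moreover have "poly_act M ?p v = 0"
    proof -
      have deg: "degree ?p \<le> j"
        using ij(2) by (intro degree_diff_le) (auto simp: degree_monom_eq)
      have "poly_act M ?p v = (\<Sum>k\<le>j. (if k = j then ?f k else 0) - (if k = i then ?f k else 0))"
        unfolding poly_act_bound[OF deg]
        by (intro sum.cong) (use ij(2) in auto)
      also have "\<dots> = ?f j - ?f i" using ij(2) by (simp add: sum_subtractf)
      finally show ?thesis using ij(1) by simp
    qed
    ultimately show ?thesis by blast
  next
    case True
    let ?S = "?f ` {..?n}"
    have "card ?S = Suc ?n" using True by (simp add: card_image)
    moreover have "vec.dim ?S \<le> ?n" by (rule dim_subset_UNIV_cart_gen)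
    ultimately have "vec.dependent ?S"
      using vec.independent_card_le_dim[of ?S ?S] by auto
    then obtain u where u: "\<exists>w\<in>?S. u w \<noteq> 0" "(\<Sum>w\<in>?S. u w *s w) = 0"
      using vec.dependent_finite[of ?S] by auto
    let ?p = "\<Sum>i\<le>?n. monom (u (?f i)) i"
    have co: "coeff ?p k = (if k \<le> ?n then u (?f k) else 0)" for k
      by (simp add: coeff_sum)
    have "?p \<noteq> 0"
    proof
      assume p0: "?p = 0"
      obtain k where k: "k \<le> ?n" "u (?f k) \<noteq> 0" using u(1) by auto
      then show False using co[of k] by (simp add: p0)
    qed
    moreover have "poly_act M ?p v = 0"
    proof -
      have "degree ?p \<le> ?n" by (rule degree_le) (auto simp: co)
      then have "poly_act M ?p v = (\<Sum>i\<le>?n. coeff ?p i *s ?f i)" by (rule poly_act_bound)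
      also have "\<dots> = (\<Sum>i\<le>?n. u (?f i) *s ?f i)" by (simp add: co)
      also have "\<dots> = (\<Sum>w\<in>?S. u w *s w)" using True by (simp add: sum.reindex)
      finally show ?thesis using u(2) by simp
    qed
    ultimately show ?thesis by blast
  qed
qed

text \<open>
  Modulo the generalized eigenspace of \<open>\<mu>\<close>, the map \<open>M - \<mu>\<close> sends \<open>W\<close> onto itself, because it is
  onto on each of the other generalized eigenspaces. So \<open>v\<close> can be corrected by an element of \<open>W\<close>
  until \<open>M - \<mu>\<close> sends it into the generalized eigenspace of \<open>\<mu>\<close>, to which it then belongs.
\<close>

lemma in_span_if_shift_in_span:
  fixes M :: "real^'n^'n"
  defines "W \<equiv> vec.span (\<Union>\<nu>. generalized_eigenspace M \<nu>)"
  assumes "shift M \<mu> v \<in> W"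
  shows "v \<in> W"
proof -
  have dec: "\<exists>w\<in>W. u - shift M \<mu> w \<in> generalized_eigenspace M \<mu>" if "u \<in> W" for u
    using that[unfolded W_def]
  proof (induction rule: vec.span_induct_alt)
    case base
    show ?case by (intro bexI[of _ 0]) (auto simp: W_def vec.span_zero)
  next
    case (step c x y)
    then obtain w where w: "w \<in> W" "y - shift M \<mu> w \<in> generalized_eigenspace M \<mu>" by blast
    obtain \<nu> where x: "x \<in> generalized_eigenspace M \<nu>" using step by blast
    show ?case
    proof (cases "\<nu> = \<mu>")
      case True
      have "c *s x + y - shift M \<mu> w = c *s x + (y - shift M \<mu> w)" by simp
      also have "\<dots> \<in> generalized_eigenspace M \<mu>"
        using x True w(2) by (intro generalized_eigenspace_linear) auto
      finally show ?thesis using w(1) by blast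
    next
      case False
      then obtain z where z: "z \<in> generalized_eigenspace M \<nu>" "shift M \<mu> z = x"
        using shift_onto_generalized_eigenspace[OF x] by blast
      have "z \<in> W" unfolding W_def using z(1) by (intro vec.span_base) blast
      then have "c *s z + w \<in> W"
        using w(1) unfolding W_def by (intro vec.span_add vec.span_scale)
      moreover have "c *s x + y - shift M \<mu> (c *s z + w) = y - shift M \<mu> w"
        unfolding shift_linear z(2) by simp
      ultimately show ?thesis using w(2) by (metis (no_types, lifting))
    qed
  qed
  obtain w where w: "w \<in> W" "shift M \<mu> v - shift M \<mu> w \<in> generalized_eigenspace M \<mu>"
    using dec[OF assms(2)] by blast
  have "shift M \<mu> v - shift M \<mu> w = shift M \<mu> (v - w)"
    by (simp add: vec.diff vec.scale_right_diff_distrib)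
  then have "v - w \<in> generalized_eigenspace M \<mu>"
    using w(2) generalized_eigenspace_if_shift by metis
  then have "v - w \<in> W" unfolding W_def by (intro vec.span_base) blast
  then have "(v - w) + w \<in> W" using w(1) unfolding W_def by (rule vec.span_add)
  then show ?thesis by simp
qed

text \<open>
  Every vector is annihilated by a nonzero polynomial in \<open>M\<close>, which splits into linear factors over
  the complex numbers; these are peeled off one at a time with \<open>in_span_if_shift_in_span\<close>.
\<close>

theorem generalized_eigenspaces_span:
  fixes M :: "real^'n^'n"
  shows "vec.span (\<Union>\<mu>\<in>{\<mu>. eigenvalue M \<mu>}. generalized_eigenspace M \<mu>) = UNIV"
proof -
  let ?U = "\<Union>\<nu>. generalized_eigenspace M \<nu>"
  have main: "v \<in> vec.span ?U" if "p \<noteq> 0" "poly_act M p v = 0" for p v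
    using that
  proof (induction "degree p" arbitrary: p v)
    case 0
    then obtain a where "p = [:a:]" "a \<noteq> 0" by (metis degree_eq_zeroE pCons_0_0)
    then have "v = 0" using 0 by (simp add: poly_act_def)
    then show ?case by (simp add: vec.span_zero)
  next
    case (Suc d)
    have "\<not> constant (poly p)" using Suc(2) by (simp add: constant_degree)
    then obtain \<mu> where "poly p \<mu> = 0" using fundamental_theorem_of_algebra by blast
    then obtain q where q: "p = [:-\<mu>, 1:] * q" by (auto simp: poly_eq_0_iff_dvd elim: dvdE)
    have "q \<noteq> 0" using Suc(3) q by auto
    then have "degree q = d" using Suc(2) unfolding q by (subst (asm) degree_mult_eq) auto
    then have "shift M \<mu> v \<in> vec.span ?U"
      using Suc(1)[of q "shift M \<mu> v"] \<open>q \<noteq> 0\<close> Suc(4) unfolding q poly_act_linear_factor by auto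
    then show ?case by (rule in_span_if_shift_in_span)
  qed
  have "v \<in> vec.span ?U" for v
    using annihilating_poly_exists[of M v] main by blast
  moreover have "vec.span ?U \<subseteq> vec.span (\<Union>\<mu>\<in>{\<mu>. eigenvalue M \<mu>}. generalized_eigenspace M \<mu>)"
  proof (rule vec.span_minimal)
    show "?U \<subseteq> vec.span (\<Union>\<mu>\<in>{\<mu>. eigenvalue M \<mu>}. generalized_eigenspace M \<mu>)"
    proof
      fix v assume "v \<in> ?U"
      then obtain \<nu> where v: "v \<in> generalized_eigenspace M \<nu>" by blast
      show "v \<in> vec.span (\<Union>\<mu>\<in>{\<mu>. eigenvalue M \<mu>}. generalized_eigenspace M \<mu>)"
      proof (cases "eigenvalue M \<nu>")
        case True
        then show ?thesis using v by (intro vec.span_base) blast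
      next
        case False
        then show ?thesis using generalized_eigenspace_trivial[OF v] by (simp add: vec.span_zero)
      qed
    qed
  qed (rule vec.subspace_span)
  ultimately show ?thesis by blast
qed

section \<open>Eigenvalues of real matrices\<close>

lemma complex_matrix_mult: "complex_matrix (X ** Y) = complex_matrix X ** complex_matrix Y"
  by (simp add: vec_eq_iff matrix_matrix_mult_def)

lemma complex_matrix_vector: "complex_matrix X *v complex_vector x = complex_vector (X *v x)"
  by (simp add: vec_eq_iff matrix_vector_mult_def)

lemma complex_matrix_eq_0_iff: "(\<forall>v. complex_matrix X *v v = 0) \<longleftrightarrow> X = 0"
proof
  assume *: "\<forall>v. complex_matrix X *v v = 0"
  have "X *v x = 0 *v x" for x
    using *[rule_format, of "complex_vector x"] unfolding complex_matrix_vector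
    by (simp add: vec_eq_iff)
  then show "X = 0" by (subst matrix_eq) blast
qed (simp add: vec_eq_iff matrix_vector_mult_def)

text \<open>
  Real and imaginary part of an eigenvector. With this description, arguments about quadratic forms
  stay within real vectors and need no Hermitian inner product.
\<close>

lemma eigenvalue_iff_real_parts:
  "eigenvalue M \<mu> \<longleftrightarrow> (\<exists>x y. (x \<noteq> 0 \<or> y \<noteq> 0) \<and>
      M *v x = Re \<mu> *\<^sub>R x - Im \<mu> *\<^sub>R y \<and> M *v y = Im \<mu> *\<^sub>R x + Re \<mu> *\<^sub>R y)"
  (is "_ \<longleftrightarrow> ?R")
proof
  assume "eigenvalue M \<mu>"
  then obtain v where v: "v \<noteq> 0" "complex_matrix M *v v = \<mu> *s v" by (auto simp: eigenvalue_def)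
  define x y where "x = (\<chi> i. Re (v $ i))" and "y = (\<chi> i. Im (v $ i))"
  have "x \<noteq> 0 \<or> y \<noteq> 0"
    using v(1) by (auto simp: x_def y_def vec_eq_iff complex_eq_iff)
  moreover have "Re ((complex_matrix M *v v) $ i) = Re ((\<mu> *s v) $ i)"
    "Im ((complex_matrix M *v v) $ i) = Im ((\<mu> *s v) $ i)" for i
    by (simp_all only: v(2))
  then have "M *v x = Re \<mu> *\<^sub>R x - Im \<mu> *\<^sub>R y" "M *v y = Im \<mu> *\<^sub>R x + Re \<mu> *\<^sub>R y"
    by (simp_all add: vec_eq_iff x_def y_def matrix_vector_mult_def)
  ultimately show ?R by blast
next
  assume ?R
  then obtain x y where xy: "x \<noteq> 0 \<or> y \<noteq> 0"
    and x: "M *v x = Re \<mu> *\<^sub>R x - Im \<mu> *\<^sub>R y" and y: "M *v y = Im \<mu> *\<^sub>R x + Re \<mu> *\<^sub>R y"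
    by blast
  define v where "v = (\<chi> i. Complex (x $ i) (y $ i))"
  have "v \<noteq> 0" using xy by (auto simp: v_def vec_eq_iff complex_eq_iff)
  moreover have "complex_matrix M *v v = \<mu> *s v"
    using x y by (simp add: vec_eq_iff v_def matrix_vector_mult_def complex_eq_iff)
  ultimately show "eigenvalue M \<mu>" by (auto simp: eigenvalue_def)
qed

lemma eigenvalue_iff_det: "eigenvalue M \<mu> \<longleftrightarrow> det (complex_matrix M - mat \<mu>) = 0"
proof -
  have "det (complex_matrix M - mat \<mu>) \<noteq> 0
      \<longleftrightarrow> (\<forall>v. (complex_matrix M - mat \<mu>) *v v = 0 \<longrightarrow> v = 0)"
    by (simp only: invertible_det_nz[symmetric] invertible_left_inverse matrix_left_invertible_ker)
  then show ?thesis
    unfolding eigenvalue_def by (auto simp: matrix_vector_mult_diff_rdistrib mat_mult_vector)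
qed

lemma eigenvalue_transpose: "eigenvalue (transpose M) \<mu> \<longleftrightarrow> eigenvalue M \<mu>"
proof -
  have "complex_matrix (transpose M) - mat \<mu> = transpose (complex_matrix M - mat \<mu>)"
    by (simp add: vec_eq_iff transpose_def mat_def)
  then show ?thesis by (simp add: eigenvalue_iff_det)
qed

lemma eigenvalue_uminus: "eigenvalue (- M) \<mu> \<longleftrightarrow> eigenvalue M (- \<mu>)"
proof -
  have "complex_matrix (- M) *v v = - (complex_matrix M *v v)" for v
    by (simp add: vec_eq_iff matrix_vector_mult_def sum_negf)
  moreover have "- w = \<mu> *s v \<longleftrightarrow> w = (- \<mu>) *s v" for v w :: "complex^'a"
    by (metis (no_types) add.inverse_inverse vec.scale_minus_left)
  ultimately show ?thesis by (simp only: eigenvalue_def)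
qed

lemma stable_transpose: "stable (transpose M) \<longleftrightarrow> stable M"
  by (simp add: stable_def eigenvalue_transpose)

section \<open>Intertwined matrices\<close>

lemma shift_intertwining:
  assumes "H ** Z = Z ** M"
  shows "shift H \<mu> (complex_matrix Z *v v) = complex_matrix Z *v shift M \<mu> v"
  using arg_cong[OF assms, of complex_matrix]
  by (simp add: complex_matrix_mult matrix_vector_mul_assoc vec.diff vec.scale)

lemma generalized_eigenspace_intertwining:
  assumes "H ** Z = Z ** M" and "v \<in> generalized_eigenspace M \<mu>"
  shows "complex_matrix Z *v v \<in> generalized_eigenspace H \<mu>"
  using assms(2)
proof (induction rule: generalized_eigenspace_induct)
  case (shift v)
  then show ?case
    using generalized_eigenspace_if_shift[where M = H and \<mu> = \<mu> and v = "complex_matrix Z *v v"]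
    unfolding shift_intertwining[OF assms(1)] by blast
qed simp

text \<open>
  \<open>Z\<close> maps the generalized eigenspace of \<open>M\<close> at \<open>\<mu>\<close> into the one of \<open>H\<close> at \<open>\<mu>\<close>,
  which is zero for an eigenvalue \<open>\<mu>\<close> of \<open>M\<close>. The spaces for these \<open>\<mu>\<close> span.
\<close>

lemma sylvester_unique:
  assumes "H ** Z = Z ** M" and "\<And>\<mu>. \<not> (eigenvalue M \<mu> \<and> eigenvalue H \<mu>)"
  shows "Z = 0"
proof -
  have "complex_matrix Z *v v = 0" for v
  proof -
    have "v \<in> vec.span (\<Union>\<mu>\<in>{\<mu>. eigenvalue M \<mu>}. generalized_eigenspace M \<mu>)"
      by (simp add: generalized_eigenspaces_span)
    then show ?thesis
    proof (induction rule: vec.span_induct_alt)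
      case (step c x y)
      then obtain \<mu> where "eigenvalue M \<mu>" "x \<in> generalized_eigenspace M \<mu>" by blast
      then have "complex_matrix Z *v x = 0"
        using generalized_eigenspace_intertwining[OF assms(1)] generalized_eigenspace_trivial
          assms(2) by blast
      then show ?case using step by (simp add: vec.add vec.scale)
    qed simp
  qed
  then show ?thesis using complex_matrix_eq_0_iff by blast
qed

section \<open>Decay of the Cayley transform of a stable matrix\<close>

text \<open>
  A contraction driven by a vanishing perturbation: once \<open>\<bar>w k\<bar>\<close> stays below \<open>e (1 - \<bar>c\<bar>) / 2\<close>,
  the perturbations add up to at most \<open>e / 2\<close>, and the contribution of the past decays geometrically.
\<close>

lemma linear_recurrence_tendsto_0:
  fixes z w :: "nat \<Rightarrow> complex"
  assumes rec: "\<And>k. z (Suc k) = c * z k + w k" and "cmod c < 1" and "w \<longlonglongrightarrow> 0"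
  shows "z \<longlonglongrightarrow> 0"
proof (rule LIMSEQ_I)
  fix e :: real assume "e > 0"
  let ?q = "cmod c"
  have "e * (1 - ?q) / 2 > 0" using \<open>e > 0\<close> assms(2) by simp
  then obtain N where N: "\<And>k. k \<ge> N \<Longrightarrow> cmod (w k) < e * (1 - ?q) / 2"
    using LIMSEQ_D[OF assms(3)] by (metis diff_zero)
  have bound: "cmod (z (N + j)) \<le> ?q ^ j * cmod (z N) + e / 2" for j
  proof (induction j)
    case 0
    then show ?case using \<open>e > 0\<close> by simp
  next
    case (Suc j)
    have "cmod (z (N + Suc j)) \<le> ?q * cmod (z (N + j)) + cmod (w (N + j))"
      using rec[of "N + j"] norm_triangle_ineq[of "c * z (N + j)" "w (N + j)"]
      by (simp add: norm_mult)
    also have "\<dots> \<le> ?q * (?q ^ j * cmod (z N) + e / 2) + e * (1 - ?q) / 2"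
      by (intro add_mono mult_left_mono Suc less_imp_le[OF N]) auto
    also have "\<dots> = ?q ^ Suc j * cmod (z N) + e / 2" by (simp add: field_simps)
    finally show ?case .
  qed
  have "(\<lambda>j. ?q ^ j * cmod (z N)) \<longlonglongrightarrow> 0 * cmod (z N)"
    by (intro tendsto_mult tendsto_const LIMSEQ_power_zero) (use assms(2) in auto)
  then obtain J where J: "\<And>j. j \<ge> J \<Longrightarrow> ?q ^ j * cmod (z N) < e / 2"
    using LIMSEQ_D[of "\<lambda>j. ?q ^ j * cmod (z N)" 0 "e / 2"] \<open>e > 0\<close> by fastforce
  have "cmod (z k) < e" if "k \<ge> N + J" for k
  proof -
    have "J \<le> k - N" "N + (k - N) = k" using that by auto
    then show ?thesis using bound[of "k - N"] J[of "k - N"] by simp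
  qed
  then show "\<exists>no. \<forall>n\<ge>no. norm (z n - 0) < e" by auto
qed

lemma funpow_matrix_add:
  fixes T :: "complex^'n^'n"
  shows "((*v) T ^^ k) (v + w) = ((*v) T ^^ k) v + ((*v) T ^^ k) w"
  by (induction k) (simp_all add: vec.add)

lemma funpow_matrix_scale:
  fixes T :: "complex^'n^'n"
  shows "((*v) T ^^ k) (c *s v) = c *s ((*v) T ^^ k) v"
  by (induction k) (simp_all add: vec.scale)

text \<open>
  The Cayley transform \<open>S = (1 + M)(1 - M)\<^sup>-\<^sup>1\<close> moves the open left half-plane into the unit disc:
  \<open>\<bar>1 + \<mu>\<bar> < \<bar>1 - \<mu>\<bar>\<close> if \<open>Re \<mu> < 0\<close>. For \<open>u = (M - \<mu>)v\<close> one has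
  \<open>Sv = a v + (u + Su) / (1 - \<mu>)\<close> with \<open>a = (1 + \<mu>) / (1 - \<mu>)\<close>, so the iterates of a generalized
  eigenvector \<open>v\<close> satisfy a contracting recurrence, driven by those of the next vector of its chain.
  Iterating \<open>S\<close> takes the place of following the flow \<open>exp(tM)\<close>.
\<close>

lemma cayley_powers_tendsto_0:
  fixes M S :: "real^'n^'n"
  assumes "stable M" and S: "S ** (mat 1 - M) = mat 1 + M"
  shows "(\<lambda>k. ((*v) S ^^ k) x) \<longlonglongrightarrow> 0"
proof -
  let ?T = "complex_matrix S"
  let ?tail = "\<lambda>v i k. ((*v) ?T ^^ k) v $ i"
  have cS: "?T *v (v - complex_matrix M *v v) = v + complex_matrix M *v v" for v
  proof -
    have "complex_matrix (S ** (mat 1 - M)) *v v = complex_matrix (mat 1 + M) *v v"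
      by (simp only: S)
    moreover have "complex_matrix (mat 1 - M) = mat 1 - complex_matrix M"
      "complex_matrix (mat 1 + M) = mat 1 + complex_matrix M"
      by (simp_all add: vec_eq_iff mat_def)
    ultimately show ?thesis
      by (simp add: complex_matrix_mult matrix_vector_mult_diff_rdistrib
          matrix_vector_mult_add_rdistrib flip: matrix_vector_mul_assoc)
  qed
  have gen: "?tail v i \<longlonglongrightarrow> 0"
    if "v \<in> generalized_eigenspace M \<mu>" "Re \<mu> < 0" for v \<mu> i
    using that(1)
  proof (induction arbitrary: i rule: generalized_eigenspace_induct)
    case zero
    have "((*v) ?T ^^ k) 0 = 0" for k by (induction k) auto
    then show ?case by simp
  next
    case (shift v)
    define u where "u = shift M \<mu> v"
    define a where "a = (1 + \<mu>) / (1 - \<mu>)"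
    have \<mu>: "1 - \<mu> \<noteq> 0" using that(2) by (auto simp: complex_eq_iff)
    have Mv: "complex_matrix M *v v = \<mu> *s v + u" by (simp add: u_def)
    have "?T *v v = a *s v + (1 / (1 - \<mu>)) *s (u + ?T *v u)"
    proof -
      have "?T *v ((1 - \<mu>) *s v - u) = (1 + \<mu>) *s v + u"
        using cS[of v]
        by (simp add: Mv algebra_simps vec.scale_left_distrib vec.scale_left_diff_distrib)
      then have "(1 - \<mu>) *s (?T *v v) = (1 + \<mu>) *s v + (u + ?T *v u)"
        by (simp add: vec.diff vec.scale algebra_simps)
      moreover define Tv Tu where "Tv = ?T *v v" and "Tu = ?T *v u"
      ultimately have "(1 - \<mu>) * Tv $ i = (1 + \<mu>) * v $ i + (u $ i + Tu $ i)" for i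
        by (metis vector_add_component vector_smult_component)
      then have "Tv $ i = ((1 + \<mu>) * v $ i + (u $ i + Tu $ i)) / (1 - \<mu>)" for i
        using \<mu> by (metis nonzero_mult_div_cancel_left)
      then have "Tv $ i = a * v $ i + (1 / (1 - \<mu>)) * (u $ i + Tu $ i)" for i
        by (simp add: a_def divide_inverse algebra_simps)
      then show ?thesis
        unfolding Tv_def[symmetric] Tu_def[symmetric] by (simp add: vec_eq_iff add_divide_distrib)
    qed
    then have rec: "?tail v i (Suc k)
        = a * ?tail v i k + (1 / (1 - \<mu>)) * (?tail u i k + ?tail u i (Suc k))" for k
      by (simp add: funpow_Suc_right funpow_matrix_add funpow_matrix_scale add_divide_distrib
          del: funpow.simps)
    have "cmod (1 + \<mu>) < cmod (1 - \<mu>)"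
    proof (rule power2_less_imp_less)
      show "(cmod (1 + \<mu>))\<^sup>2 < (cmod (1 - \<mu>))\<^sup>2"
        unfolding cmod_power2 using that(2) by (simp add: power2_eq_square algebra_simps)
    qed simp
    then have "cmod a < 1" using \<mu> by (simp add: a_def norm_divide)
    moreover have u: "?tail u i \<longlonglongrightarrow> 0" using shift(2) by (simp add: u_def)
    have "(\<lambda>k. (1 / (1 - \<mu>)) * (?tail u i k + ?tail u i (Suc k))) \<longlonglongrightarrow> (1 / (1 - \<mu>)) * (0 + 0)"
      by (intro tendsto_mult tendsto_add tendsto_const u LIMSEQ_Suc[OF u])
    ultimately show ?case
      using linear_recurrence_tendsto_0[where z = "?tail v i", OF rec] by simp
  qed
  have all: "?tail v i \<longlonglongrightarrow> 0" for v i
  proof -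
    have "v \<in> vec.span (\<Union>\<mu>\<in>{\<mu>. eigenvalue M \<mu>}. generalized_eigenspace M \<mu>)"
      by (simp add: generalized_eigenspaces_span)
    then show ?thesis
    proof (induction rule: vec.span_induct_alt)
      case base
      show ?case using gen[of 0 "-1"] by simp
    next
      case (step c x y)
      then obtain \<mu> where "eigenvalue M \<mu>" "x \<in> generalized_eigenspace M \<mu>" by blast
      then have "?tail x i \<longlonglongrightarrow> 0" using gen assms(1) by (auto simp: stable_def)
      then have "(\<lambda>k. c * ?tail x i k + ?tail y i k) \<longlonglongrightarrow> c * 0 + 0"
        using step by (intro tendsto_intros) auto
      then show ?case by (simp add: funpow_matrix_add funpow_matrix_scale)
    qed
  qed
  have real: "((*v) ?T ^^ k) (complex_vector x) = complex_vector (((*v) S ^^ k) x)" for k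
    by (induction k) (simp_all add: complex_matrix_vector)
  show ?thesis
  proof (rule vec_tendstoI)
    fix i
    have "(\<lambda>k. complex_of_real (((*v) S ^^ k) x $ i)) \<longlonglongrightarrow> 0"
      using all[of "complex_vector x" i] by (simp add: real)
    then show "(\<lambda>k. ((*v) S ^^ k) x $ i) \<longlonglongrightarrow> 0 $ i"
      using tendsto_of_real_iff[where 'a=complex and c=0] by fastforce
  qed
qed

section \<open>Lyapunov equations\<close>

lemma lyapunov_form:
  fixes X :: "real^'n^'n"
  assumes "transpose X = X"
  shows "x \<bullet> ((transpose M ** X + X ** M) *v x) = 2 * ((M *v x) \<bullet> (X *v x))"
proof -
  have "x \<bullet> (transpose M *v (X *v x)) = (M *v x) \<bullet> (X *v x)" by (rule inner_transpose_mult)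
  moreover have "x \<bullet> (X *v (M *v x)) = (M *v x) \<bullet> (X *v x)"
    using inner_symmetric_mult[OF assms, of x "M *v x"] by (simp only: inner_commute)
  ultimately show ?thesis
    by (simp only: matrix_vector_mult_add_rdistrib matrix_vector_mul_assoc[symmetric] inner_add_right)
qed

text \<open>
  With \<open>x = (1 - M)y\<close> and \<open>Sx = (1 + M)y\<close> the form of \<open>X\<close> changes by
  \<open>\<langle>Sx, XSx\<rangle> - \<langle>x, Xx\<rangle> = 4\<langle>My, Xy\<rangle> \<le> 0\<close>. Hence it decreases along the iterates of \<open>S\<close>, which
  tend to \<open>0\<close>, and cannot start from a negative value.
\<close>

theorem lyapunov_pos_semidef:
  fixes M X :: "real^'n^'n"
  assumes "stable M" and X: "transpose X = X"
    and nonpos: "\<And>x. x \<bullet> ((transpose M ** X + X ** M) *v x) \<le> 0"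
  shows "pos_semidef X"
proof -
  have "y = 0" if "(mat 1 - M) *v y = 0" for y
  proof (rule ccontr)
    assume "y \<noteq> 0"
    then have "eigenvalue M 1"
      using that unfolding eigenvalue_iff_real_parts
      by (intro exI[of _ y] exI[of _ 0]) (simp add: matrix_vector_mult_diff_rdistrib)
    then show False using assms(1) by (auto simp: stable_def)
  qed
  then obtain R where "R ** (mat 1 - M) = mat 1"
    using matrix_left_invertible_ker[of "mat 1 - M"] by blast
  then have R: "R ** (mat 1 - M) = mat 1" "(mat 1 - M) ** R = mat 1"
    using matrix_left_right_inverse by blast+
  define S where "S = (mat 1 + M) ** R"
  have S: "S ** (mat 1 - M) = mat 1 + M"
    by (simp add: S_def R flip: matrix_mul_assoc)
  have decr: "(S *v x) \<bullet> (X *v (S *v x)) \<le> x \<bullet> (X *v x)" for x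
  proof -
    define y where "y = R *v x"
    have x: "x = y - M *v y"
      using arg_cong[OF R(2), of "\<lambda>T. T *v x"]
      by (simp add: y_def matrix_vector_mult_diff_rdistrib flip: matrix_vector_mul_assoc)
    have Sx: "S *v x = y + M *v y"
      by (simp add: S_def y_def matrix_vector_mult_add_rdistrib flip: matrix_vector_mul_assoc)
    have "(S *v x) \<bullet> (X *v (S *v x)) - x \<bullet> (X *v x) = 4 * ((M *v y) \<bullet> (X *v y))"
      unfolding Sx using inner_symmetric_mult[OF X, of y "M *v y"]
      by (simp add: x vec.add vec.diff inner_add inner_diff inner_commute)
    then show ?thesis using nonpos[of y] by (simp only: lyapunov_form[OF X])
  qed
  have "0 \<le> x \<bullet> (X *v x)" for x
  proof -
    let ?s = "\<lambda>k. ((*v) S ^^ k) x"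
    have "?s k \<bullet> (X *v ?s k) \<le> x \<bullet> (X *v x)" for k
      by (induction k) (use decr order_trans in auto)
    moreover have "(\<lambda>k. ?s k \<bullet> (X *v ?s k)) \<longlonglongrightarrow> 0 \<bullet> (X *v 0)"
    proof (intro tendsto_inner)
      show s: "?s \<longlonglongrightarrow> 0" by (rule cayley_powers_tendsto_0[OF assms(1) S])
      show "(\<lambda>k. X *v ?s k) \<longlonglongrightarrow> X *v 0"
        by (rule bounded_linear.tendsto[OF _ s]) (simp add: linear_linear)
    qed
    ultimately show ?thesis by (intro LIMSEQ_le_const2[of _ 0]) auto
  qed
  then show ?thesis using X by (simp add: pos_semidef_def)
qed

text \<open>
  The spectra of \<open>M\<close> and \<open>-M\<^sup>T\<close> lie in opposite half-planes.
\<close>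

lemma lyapunov_injective:
  assumes "stable M" and "transpose M ** X + X ** M = 0"
  shows "X = 0"
proof (rule sylvester_unique)
  show "(- transpose M) ** X = X ** M"
    using minus_unique[OF assms(2)] by (simp only: matrix_mult_uminus_left)
  fix \<mu>
  show "\<not> (eigenvalue M \<mu> \<and> eigenvalue (- transpose M) \<mu>)"
  proof
    assume "eigenvalue M \<mu> \<and> eigenvalue (- transpose M) \<mu>"
    then have "Re \<mu> < 0" "Re (- \<mu>) < 0"
      using assms(1) unfolding eigenvalue_uminus eigenvalue_transpose stable_def by blast+
    then show False by simp
  qed
qed

text \<open>
  By injectivity the solution inherits symmetry from the right-hand side.
\<close>

theorem lyapunov_solution_exists:
  fixes M Q :: "real^'n^'n"
  assumes "stable M" and Q: "transpose Q = Q"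
  shows "\<exists>X. transpose X = X \<and> transpose M ** X + X ** M = Q"
proof -
  let ?L = "\<lambda>X. transpose M ** X + X ** M"
  have lin: "linear ?L"
  proof (rule linearI)
    show "?L (c *\<^sub>R X) = c *\<^sub>R ?L X" for c X
      by (simp only: matrix_mult_scaleR_left matrix_mult_scaleR_right scaleR_add_right)
  qed (simp add: matrix_add_ldistrib matrix_add_rdistrib)
  then have inj: "inj ?L"
    using linear_injective_0[OF lin] lyapunov_injective[OF assms(1)] by blast
  have "Q \<in> range ?L"
    using linear_injective_imp_surjective[OF lin inj] by simp
  then obtain X where X: "?L X = Q" by blast
  have "?L (transpose X) = transpose (?L X)"
    by (simp add: transpose_add matrix_transpose_mul add.commute)
  then have "?L (transpose X) = ?L X" using X Q by simp
  then have "transpose X = X" by (rule injD[OF inj])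
  then show ?thesis using X by blast
qed

section \<open>The algebraic Riccati equation\<close>

definition riccati :: "real^'n^'n \<Rightarrow> real^'n^'n \<Rightarrow> real^'n^'n \<Rightarrow> real^'n^'n \<Rightarrow> real^'n^'n" where
  "riccati A G Q P = transpose A ** P + P ** A - P ** G ** P + Q"

lemma riccati_form:
  fixes P :: "real^'n^'n" and C :: "real^'n^'p"
  assumes P: "transpose P = P"
  shows "x \<bullet> (riccati A G (transpose C ** C) P *v x)
    = 2 * ((A *v x) \<bullet> (P *v x)) - (P *v x) \<bullet> (G *v (P *v x)) + (norm (C *v x))\<^sup>2"
proof -
  have "x \<bullet> ((P ** G ** P) *v x) = (P *v x) \<bullet> (G *v (P *v x))"
    using inner_symmetric_mult[OF P, of x "G *v (P *v x)"]
    by (simp only: matrix_vector_mul_assoc[symmetric])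
  then show ?thesis
    unfolding riccati_def
    by (simp only: matrix_vector_mult_add_rdistrib matrix_vector_mult_diff_rdistrib inner_add_right
        inner_diff_right inner_gram
        lyapunov_form[OF P, unfolded matrix_vector_mult_add_rdistrib inner_add_right])
qed

text \<open>
  If \<open>w = Gx\<close> were nonzero, the form would be negative at \<open>x - s w\<close> for small \<open>s > 0\<close>: its linear
  term is \<open>-2s\<langle>w, w\<rangle>\<close>.
\<close>

lemma pos_semidef_kernel:
  assumes G: "pos_semidef G" and "x \<bullet> (G *v x) = 0"
  shows "G *v x = 0"
proof (rule ccontr)
  assume "G *v x \<noteq> 0"
  define w where "w = G *v x"
  have sym: "transpose G = G" and nn: "\<And>z. 0 \<le> z \<bullet> (G *v z)"
    using G by (auto simp: pos_semidef_def)
  have w: "w \<bullet> w > 0" using \<open>G *v x \<noteq> 0\<close> by (simp add: w_def)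
  let ?b = "w \<bullet> (G *v w)"
  \<comment> \<open>The \<open>1\<close> keeps the denominator positive when the form vanishes at \<open>w\<close>.\<close>
  define s where "s = (w \<bullet> w) / (?b + 1)"
  have b: "?b + 1 > 0" using nn[of w] by simp
  then have s: "s > 0" using w by (simp add: s_def)
  have "x \<bullet> (G *v w) = w \<bullet> w"
    using inner_symmetric_mult[OF sym, of x w] by (simp add: w_def)
  moreover have "w \<bullet> (G *v x) = w \<bullet> w" by (simp add: w_def)
  ultimately have "(x - s *\<^sub>R w) \<bullet> (G *v (x - s *\<^sub>R w)) = s * (s * ?b - 2 * (w \<bullet> w))"
    using assms(2)
    by (simp add: matrix_vector_mult_diff_distrib matrix_vector_mult_scaleR inner_diff algebra_simps)
  then have "0 \<le> s * ?b - 2 * (w \<bullet> w)"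
    using nn[of "x - s *\<^sub>R w"] s by (simp add: zero_le_mult_iff)
  moreover have "s * ?b \<le> w \<bullet> w"
  proof -
    have "s * ?b \<le> s * (?b + 1)" using s by simp
    also have "\<dots> = w \<bullet> w" using b by (simp add: s_def)
    finally show ?thesis .
  qed
  ultimately show False using w by simp
qed

text \<open>
  Output injection does not change the action of \<open>A\<close> on the kernel of \<open>C\<close>, so an eigenvector in this
  kernel survives in a stable matrix \<open>A + K\<^sup>T C\<close>.
\<close>

lemma unobservable_eigenvalue_stable:
  assumes "detectable C A" and "x \<noteq> 0 \<or> y \<noteq> 0"
    and "A *v x = Re \<mu> *\<^sub>R x - Im \<mu> *\<^sub>R y" "A *v y = Im \<mu> *\<^sub>R x + Re \<mu> *\<^sub>R y"
    and "C *v x = 0" "C *v y = 0"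
  shows "Re \<mu> < 0"
proof -
  obtain K where "stable (transpose A + transpose C ** K)"
    using assms(1) by (auto simp: detectable_def stabilizable_def)
  moreover have "transpose (transpose A + transpose C ** K) = A + transpose K ** C"
    by (simp add: transpose_add matrix_transpose_mul)
  ultimately have st: "stable (A + transpose K ** C)" by (metis stable_transpose)
  have "(A + transpose K ** C) *v z = A *v z" if "C *v z = 0" for z
    using that by (simp only: matrix_vector_mult_add_rdistrib matrix_vector_mul_assoc[symmetric]
        matrix_vector_mult_0_right add_0_right)
  then have "eigenvalue (A + transpose K ** C) \<mu>"
    unfolding eigenvalue_iff_real_parts using assms(2-) by metis
  then show ?thesis using st by (simp add: stable_def)
qed

text \<open>
  With \<open>M = A - GP\<close>, the residual at \<open>z\<close> equals
  \<open>2\<langle>Mz, Pz\<rangle> + \<langle>Pz, GPz\<rangle> + \<parallel>Cz\<parallel>\<^sup>2\<close>. Summed over the real and imaginary part of an eigenvector of \<open>M\<close>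
  whose eigenvalue is not in the open left half-plane, the first term is nonnegative. All terms
  therefore vanish, so \<open>GP\<close> and \<open>C\<close> annihilate the eigenvector. It is then an unobservable
  eigenvector of \<open>A\<close>, contrary to detectability.
\<close>

theorem stable_if_riccati_nonpos:
  fixes A G P :: "real^'n^'n" and C :: "real^'n^'p"
  assumes det: "detectable C A" and G: "pos_semidef G" and P: "pos_semidef P"
    and nonpos: "\<And>x. x \<bullet> (riccati A G (transpose C ** C) P *v x) \<le> 0"
  shows "stable (A - G ** P)"
  unfolding stable_def
proof (intro allI impI, rule ccontr)
  fix \<mu> assume "eigenvalue (A - G ** P) \<mu>" and "\<not> Re \<mu> < 0"
  let ?M = "A - G ** P"
  obtain x y where xy: "x \<noteq> 0 \<or> y \<noteq> 0"
    and x: "?M *v x = Re \<mu> *\<^sub>R x - Im \<mu> *\<^sub>R y" and y: "?M *v y = Im \<mu> *\<^sub>R x + Re \<mu> *\<^sub>R y"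
    using \<open>eigenvalue ?M \<mu>\<close> unfolding eigenvalue_iff_real_parts by blast
  have symP: "transpose P = P" and nnP: "\<And>z. 0 \<le> z \<bullet> (P *v z)"
    and nnG: "\<And>z. 0 \<le> z \<bullet> (G *v z)"
    using P G by (auto simp: pos_semidef_def)
  have AM: "A *v z = ?M *v z + G *v (P *v z)" for z
    by (simp add: matrix_vector_mult_diff_rdistrib flip: matrix_vector_mul_assoc)
  have form: "2 * ((?M *v z) \<bullet> (P *v z)) + (P *v z) \<bullet> (G *v (P *v z)) + (norm (C *v z))\<^sup>2 \<le> 0" for z
    using nonpos[of z] unfolding riccati_form[OF symP] AM
    by (simp add: inner_add inner_commute)
  have "(?M *v x) \<bullet> (P *v x) + (?M *v y) \<bullet> (P *v y) = Re \<mu> * (x \<bullet> (P *v x) + y \<bullet> (P *v y))"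
    unfolding x y using inner_symmetric_mult[OF symP, of x y]
    by (simp add: inner_diff_left inner_add_left inner_commute algebra_simps)
  moreover have "Re \<mu> * (x \<bullet> (P *v x) + y \<bullet> (P *v y)) \<ge> 0"
    using \<open>\<not> Re \<mu> < 0\<close> nnP by simp
  ultimately have sum: "(P *v x) \<bullet> (G *v (P *v x)) + (norm (C *v x))\<^sup>2
      + ((P *v y) \<bullet> (G *v (P *v y)) + (norm (C *v y))\<^sup>2) \<le> 0"
    using form[of x] form[of y] by linarith
  have zero: "(P *v x) \<bullet> (G *v (P *v x)) = 0" "(P *v y) \<bullet> (G *v (P *v y)) = 0"
    "(norm (C *v x))\<^sup>2 = 0" "(norm (C *v y))\<^sup>2 = 0"
    using sum nnG[of "P *v x"] nnG[of "P *v y"] zero_le_power2[of "norm (C *v x)"]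
      zero_le_power2[of "norm (C *v y)"] by linarith+
  have "A *v x = Re \<mu> *\<^sub>R x - Im \<mu> *\<^sub>R y" "A *v y = Im \<mu> *\<^sub>R x + Re \<mu> *\<^sub>R y"
    unfolding AM x y using pos_semidef_kernel[OF G zero(1)] pos_semidef_kernel[OF G zero(2)]
    by simp_all
  then have "Re \<mu> < 0"
    using unobservable_eigenvalue_stable[OF det xy] zero(3,4) by simp
  then show False using \<open>\<not> Re \<mu> < 0\<close> by simp
qed

text \<open>
  A stabilizing feedback \<open>K\<close> has the cost \<open>P\<close> for the running cost \<open>\<parallel>Cx\<parallel>\<^sup>2 + \<parallel>Kx\<parallel>\<^sup>2 / c\<close>. The
  weight \<open>1 / c\<close> is the one that completes the square: with \<open>w = B\<^sup>T P x\<close>, the residual of \<open>P\<close> at \<open>x\<close>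
  is at most \<open>-\<parallel>Kx + c w\<parallel>\<^sup>2 / c\<close>.
\<close>

lemma riccati_subsolution_exists:
  fixes A G :: "real^'n^'n" and B :: "real^'m^'n" and C :: "real^'n^'p"
  assumes "stabilizable A B" and c: "c > 0"
    and G: "\<And>x. c * (norm (transpose B *v x))\<^sup>2 \<le> x \<bullet> (G *v x)"
  shows "\<exists>P. pos_semidef P \<and> (\<forall>x. x \<bullet> (riccati A G (transpose C ** C) P *v x) \<le> 0)"
proof -
  obtain K where K: "stable (A + B ** K)" using assms(1) by (auto simp: stabilizable_def)
  let ?M = "A + B ** K"
  let ?Q = "- (transpose C ** C) - (1 / c) *\<^sub>R (transpose K ** K)"
  have "transpose ?Q = ?Q" by (simp add: matrix_ring_simps)
  then obtain P where P: "transpose P = P" and lyap: "transpose ?M ** P + P ** ?M = ?Q"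
    using lyapunov_solution_exists[OF K] by blast
  have Q: "x \<bullet> (?Q *v x) = - (norm (C *v x))\<^sup>2 - (norm (K *v x))\<^sup>2 / c" for x
  proof -
    have "?Q *v x = - ((transpose C ** C) *v x) - (1 / c) *\<^sub>R ((transpose K ** K) *v x)"
      by (simp only: matrix_vector_mult_diff_rdistrib matrix_vector_mult_uminus
          scaleR_matrix_vector_assoc)
    then show ?thesis by (simp only: inner_diff_right inner_minus_right inner_scaleR_right inner_gram) simp
  qed
  have "x \<bullet> (?Q *v x) \<le> 0" for x
  proof -
    have "(norm (K *v x))\<^sup>2 / c \<ge> 0" using c by simp
    then show ?thesis unfolding Q using zero_le_power2[of "norm (C *v x)"] by linarith
  qed
  then have "pos_semidef P"
    by (intro lyapunov_pos_semidef[OF K P]) (simp only: lyap)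
  moreover have "x \<bullet> (riccati A G (transpose C ** C) P *v x) \<le> 0" for x
  proof -
    define p w k where "p = P *v x" and "w = transpose B *v p" and "k = K *v x"
    have "(?M *v x) \<bullet> p = (A *v x) \<bullet> p + k \<bullet> w"
      using inner_transpose_mult[of k B p]
      by (simp add: w_def k_def matrix_vector_mult_add_rdistrib inner_add_left
          flip: matrix_vector_mul_assoc del: transpose_matrix_vector)
    moreover have "2 * ((?M *v x) \<bullet> p) = - (norm (C *v x))\<^sup>2 - (norm k)\<^sup>2 / c"
      using lyapunov_form[OF P, of x ?M] unfolding lyap Q p_def k_def by simp
    ultimately have "x \<bullet> (riccati A G (transpose C ** C) P *v x)
        = - (norm k)\<^sup>2 / c - 2 * (k \<bullet> w) - p \<bullet> (G *v p)"
      unfolding riccati_form[OF P] p_def[symmetric] by simp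
    also have "\<dots> \<le> - ((norm k)\<^sup>2 / c + 2 * (k \<bullet> w) + c * (norm w)\<^sup>2)"
      using G[of p] by (simp add: w_def del: transpose_matrix_vector)
    also have "\<dots> = - ((norm (k + c *\<^sub>R w))\<^sup>2 / c)"
      using c by (simp add: power2_norm_eq_inner inner_add inner_commute field_simps)
    also have "\<dots> \<le> 0" using c by simp
    finally show ?thesis .
  qed
  ultimately show ?thesis by blast
qed

text \<open>
  \<open>P'\<close> solves the Riccati equation linearized at \<open>P\<close>, a Lyapunov equation with the stable matrix
  \<open>M = A - GP\<close> (Kleinman's iteration). The difference \<open>P - P'\<close> solves the Lyapunov equation whose
  right-hand side is the residual of \<open>P\<close>, hence \<open>P' \<le> P\<close>; the residual of \<open>P'\<close> is the quadratic
  remainder of the linearization.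
\<close>

lemma newton_step:
  fixes A G P :: "real^'n^'n" and C :: "real^'n^'p"
  assumes det: "detectable C A" and G: "pos_semidef G" and P: "pos_semidef P"
    and nonpos: "\<And>x. x \<bullet> (riccati A G (transpose C ** C) P *v x) \<le> 0"
  obtains P' where "pos_semidef P'" "pos_semidef (P - P')"
    "riccati A G (transpose C ** C) P' = - ((P - P') ** G ** (P - P'))"
proof -
  let ?Q = "transpose C ** C"
  let ?M = "A - G ** P"
  have M: "stable ?M" by (rule stable_if_riccati_nonpos[OF det G P nonpos])
  have symP: "transpose P = P" and symG: "transpose G = G" and nnG: "\<And>z. 0 \<le> z \<bullet> (G *v z)"
    using P G by (auto simp: pos_semidef_def)
  have "transpose (- (?Q + P ** G ** P)) = - (?Q + P ** G ** P)"
    by (simp add: matrix_ring_simps symP symG)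
  then obtain P' where P': "transpose P' = P'"
    and lyap: "transpose ?M ** P' + P' ** ?M = - (?Q + P ** G ** P)"
    using lyapunov_solution_exists[OF M] by blast
  have psd: "pos_semidef P'"
  proof (rule lyapunov_pos_semidef[OF M P'])
    fix x
    have "x \<bullet> ((P ** G ** P) *v x) = (P *v x) \<bullet> (G *v (P *v x))"
      using inner_symmetric_mult[OF symP, of x "G *v (P *v x)"]
      by (simp only: matrix_vector_mul_assoc[symmetric])
    moreover have "- (?Q + P ** G ** P) *v x = - (?Q *v x + (P ** G ** P) *v x)"
      by (simp only: matrix_vector_mult_uminus matrix_vector_mult_add_rdistrib)
    ultimately show "x \<bullet> ((transpose ?M ** P' + P' ** ?M) *v x) \<le> 0"
      unfolding lyap using nnG[of "P *v x"] zero_le_power2[of "norm (C *v x)"]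
      by (simp only: inner_minus_right inner_add_right inner_gram)
  qed
  have symM: "transpose ?M = transpose A - P ** G"
    by (simp add: matrix_ring_simps symP symG)
  have ric: "riccati A G ?Q P' = - ((P - P') ** G ** (P - P'))"
  proof -
    have "riccati A G ?Q P' = (transpose ?M ** P' + P' ** ?M) + (?Q + P ** G ** P)
        - (P - P') ** G ** (P - P')"
      unfolding symM by (simp add: riccati_def matrix_ring_simps algebra_simps)
    then show ?thesis by (simp only: lyap) simp
  qed
  have diff: "transpose ?M ** (P - P') + (P - P') ** ?M = riccati A G ?Q P"
  proof -
    have "transpose ?M ** (P - P') + (P - P') ** ?M
        = transpose ?M ** P + P ** ?M - (transpose ?M ** P' + P' ** ?M)"
      by (simp add: matrix_diff_ldistrib matrix_diff_rdistrib)
    also have "\<dots> = riccati A G ?Q P"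
      unfolding lyap unfolding symM by (simp add: riccati_def matrix_ring_simps algebra_simps)
    finally show ?thesis .
  qed
  have "pos_semidef (P - P')"
  proof (rule lyapunov_pos_semidef[OF M])
    show "transpose (P - P') = P - P'" by (simp add: transpose_diff symP P')
  qed (simp only: diff nonpos)
  then show thesis using that psd ric by blast
qed

text \<open>
  Evaluating the form at \<open>e\<^sub>i \<plusminus> e\<^sub>j\<close> bounds an entry by the mean of two diagonal entries. This is why
  the trace can serve as the size of a positive semidefinite matrix.
\<close>

lemma pos_semidef_entry_le_trace:
  fixes P :: "real^'n^'n"
  assumes "pos_semidef P"
  shows "\<bar>P $ i $ j\<bar> \<le> trace P"
proof -
  have nn: "0 \<le> x \<bullet> (P *v x)" for x using assms by (simp add: pos_semidef_def)
  have entry: "axis k 1 \<bullet> (P *v axis l 1) = P $ k $ l" for k l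
    by (simp add: inner_axis' matrix_vector_mult_basis column_def)
  have sym: "P $ j $ i = P $ i $ j"
  proof -
    have "transpose P $ i $ j = P $ i $ j" using assms by (simp add: pos_semidef_def)
    then show ?thesis by (simp add: transpose_def)
  qed
  have diag: "0 \<le> P $ k $ k" for k using nn[of "axis k 1"] by (simp add: entry)
  have le: "P $ k $ k \<le> trace P" for k
    unfolding trace_def by (rule member_le_sum) (auto simp: diag)
  have "0 \<le> P $ i $ i + P $ j $ j + 2 * P $ i $ j"
    using nn[of "axis i 1 + axis j 1"] by (simp add: vec.add inner_add entry sym)
  moreover have "0 \<le> P $ i $ i + P $ j $ j - 2 * P $ i $ j"
    using nn[of "axis i 1 - axis j 1"] by (simp add: vec.diff inner_diff entry sym)
  ultimately show ?thesis using le[of i] le[of j] by linarith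
qed

text \<open>
  Closed because for symmetric \<open>P\<close> the residual is a continuous function of \<open>P\<close> at each vector, bounded
  because the trace controls all entries.
\<close>

lemma compact_subsolutions:
  fixes A G :: "real^'n^'n" and C :: "real^'n^'p"
  shows "compact {P. pos_semidef P \<and> (\<forall>x. x \<bullet> (riccati A G (transpose C ** C) P *v x) \<le> 0)
    \<and> trace P \<le> t}" (is "compact ?S")
proof -
  have cont_mult [continuous_intros]: "continuous_on UNIV (\<lambda>P :: real^'n^'n. P *v x)" for x
  proof (rule linear_continuous_on)
    have "linear (\<lambda>P :: real^'n^'n. P *v x)"
      by (rule linearI) (simp_all add: matrix_vector_mult_add_rdistrib scaleR_matrix_vector_assoc)
    then show "bounded_linear (\<lambda>P :: real^'n^'n. P *v x)" by (simp add: linear_linear)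
  qed
  have cont_G [continuous_intros]: "continuous_on UNIV (\<lambda>P :: real^'n^'n. G *v (P *v x))" for x
    by (rule continuous_on_compose2[OF linear_continuous_on[of "(*v) G"] cont_mult])
      (auto simp: linear_linear)
  have S: "?S = (\<Inter>i j. {P. P $ i $ j = P $ j $ i}) \<inter> (\<Inter>x. {P. 0 \<le> x \<bullet> (P *v x)})
      \<inter> (\<Inter>x. {P. 2 * ((A *v x) \<bullet> (P *v x)) - (P *v x) \<bullet> (G *v (P *v x)) + (norm (C *v x))\<^sup>2 \<le> 0})
      \<inter> {P. trace P \<le> t}" (is "_ = ?S'")
  proof -
    have "transpose P = P \<longleftrightarrow> (\<forall>i j. P $ i $ j = P $ j $ i)" for P :: "real^'n^'n"
      by (auto simp: vec_eq_iff transpose_def)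
    then show ?thesis
      by (auto simp: pos_semidef_def riccati_form)
  qed
  have "closed ?S'"
    unfolding trace_def
    by (intro closed_Int closed_INT ballI closed_Collect_eq closed_Collect_le continuous_intros)
  moreover have "bounded ?S"
    unfolding bounded_iff
  proof (intro exI ballI)
    fix P assume P: "P \<in> ?S"
    have "norm (P $ i) \<le> CARD('n) * t" for i
    proof -
      have "norm (P $ i) \<le> (\<Sum>j\<in>UNIV. \<bar>P $ i $ j\<bar>)" by (rule norm_le_l1_cart)
      also have "\<dots> \<le> (\<Sum>j\<in>(UNIV :: 'n set). t)"
        using P by (intro sum_mono order_trans[OF pos_semidef_entry_le_trace]) auto
      finally show ?thesis by simp
    qed
    then have "(\<Sum>i\<in>UNIV. norm (P $ i)) \<le> (\<Sum>i\<in>(UNIV :: 'n set). CARD('n) * t)"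
      by (intro sum_mono)
    then show "norm P \<le> CARD('n) * (CARD('n) * t)"
      using L2_set_le_sum[of UNIV "\<lambda>i. norm (P $ i)"] by (simp add: norm_vec_def)
  qed
  ultimately show ?thesis unfolding S by (simp add: compact_eq_bounded_closed)
qed

text \<open>
  A subsolution \<open>P\<close> of minimal trace is a fixed point of the Newton step: the difference \<open>P - P'\<close> is
  positive semidefinite of trace at most \<open>0\<close>, hence zero.
\<close>

theorem stabilizing_riccati_solution_exists:
  fixes A G :: "real^'n^'n" and B :: "real^'m^'n" and C :: "real^'n^'p"
  assumes "stabilizable A B" and det: "detectable C A" and symG: "transpose G = G"
    and c: "c > 0" and Gc: "\<And>x. c * (norm (transpose B *v x))\<^sup>2 \<le> x \<bullet> (G *v x)"
  shows "\<exists>P. pos_semidef P \<and> riccati A G (transpose C ** C) P = 0 \<and> stable (A - G ** P)"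
proof -
  let ?ric = "riccati A G (transpose C ** C)"
  let ?sub = "\<lambda>P. pos_semidef P \<and> (\<forall>x. x \<bullet> (?ric P *v x) \<le> 0)"
  have G: "pos_semidef G"
    unfolding pos_semidef_def
  proof (intro conjI allI symG)
    show "0 \<le> x \<bullet> (G *v x)" for x
      using c by (intro order_trans[OF _ Gc]) simp
  qed
  obtain P1 where P1: "?sub P1"
    using riccati_subsolution_exists[OF assms(1) c Gc] by blast
  let ?S = "{P. pos_semidef P \<and> (\<forall>x. x \<bullet> (?ric P *v x) \<le> 0) \<and> trace P \<le> trace P1}"
  have cont: "continuous_on ?S trace"
    unfolding trace_def by (intro continuous_intros)
  have "?S \<noteq> {}" using P1 by blast
  then have "\<exists>P\<in>?S. \<forall>P'\<in>?S. trace P \<le> trace P'"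
    by (rule continuous_attains_inf[OF compact_subsolutions _ cont])
  then obtain P where P: "P \<in> ?S" and min: "\<And>P'. P' \<in> ?S \<Longrightarrow> trace P \<le> trace P'" by blast
  have psd: "pos_semidef P" and sub: "\<And>x. x \<bullet> (?ric P *v x) \<le> 0" using P by auto
  obtain P' where P': "pos_semidef P'" "pos_semidef (P - P')"
    and ric: "?ric P' = - ((P - P') ** G ** (P - P'))"
    using newton_step[OF det G psd sub] .
  have symD: "transpose (P - P') = P - P'" using P'(2) by (simp add: pos_semidef_def)
  have "x \<bullet> (?ric P' *v x) \<le> 0" for x
  proof -
    have "?ric P' *v x = - ((P - P') *v (G *v ((P - P') *v x)))"
      by (simp only: ric matrix_vector_mult_uminus matrix_vector_mul_assoc matrix_mul_assoc)
    then have "x \<bullet> (?ric P' *v x) = - (((P - P') *v x) \<bullet> (G *v ((P - P') *v x)))"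
      using inner_symmetric_mult[OF symD, of x] by (simp only: inner_minus_right)
    then show ?thesis using G by (simp add: pos_semidef_def)
  qed
  moreover have tr: "trace (P - P') = trace P - trace P'"
    by (simp add: trace_def sum_subtractf)
  moreover have "0 \<le> trace (P - P')"
    using pos_semidef_entry_le_trace[OF P'(2)] abs_ge_zero order_trans by blast
  ultimately have "P' \<in> ?S" using P'(1) P by auto
  then have "trace (P - P') \<le> 0" using min tr by simp
  then have "\<bar>(P - P') $ i $ j\<bar> \<le> 0" for i j
    using pos_semidef_entry_le_trace[OF P'(2)] order_trans by blast
  then have "P' = P" by (simp add: vec_eq_iff)
  moreover have "(0 :: real^'n^'n) ** G ** 0 = 0" by (simp add: vec_eq_iff matrix_matrix_mult_def)
  ultimately have "?ric P = 0" using ric by simp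
  then show ?thesis
    using psd stable_if_riccati_nonpos[OF det G psd sub] by blast
qed

section \<open>The Riccati domain\<close>

text \<open>
  An injective \<open>W\<close> carries the standard basis to its columns, without repetitions.
\<close>

lemma columns_basis_iff_range:
  fixes W :: "real^'k^'n"
  assumes "inj ((*v) W)"
  shows "columns_basis W S \<longleftrightarrow> range ((*v) W) = S"
proof -
  have "inj (\<lambda>j. column j W)"
  proof (rule injI)
    fix i j assume "column i W = column j W"
    then have "W *v axis i 1 = W *v axis j 1" by (simp add: matrix_vector_mult_basis)
    then show "i = j" using assms by (auto simp: inj_eq axis_eq_axis)
  qed
  moreover have cols: "columns W = (*v) W ` Basis"
    by (auto simp: columns_def Basis_vec_def image_UN simp flip: matrix_vector_mult_basis)
  moreover have "independent (columns W)"
    unfolding cols by (rule linear_independent_injective_image)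
      (use assms in \<open>auto simp: independent_Basis\<close>)
  moreover have "span (columns W) = range ((*v) W)"
    unfolding cols by (simp add: linear_span_image)
  ultimately show ?thesis by (simp add: columns_basis_def)
qed

lemma sum_over_blocks:
  "(\<Sum>k\<in>(UNIV :: ('a::finite + 'b::finite) set). f k) = (\<Sum>a\<in>UNIV. f (Inl a)) + (\<Sum>b\<in>UNIV. f (Inr b))"
  by (simp add: sum.Plus flip: UNIV_Plus_UNIV)

lemma block_matrix_mult_stack:
  "block_matrix M11 M12 M21 M22 ** stack_matrix U1 U2
    = stack_matrix (M11 ** U1 + M12 ** U2) (M21 ** U1 + M22 ** U2)"
  by (simp add: vec_eq_iff block_matrix_def stack_matrix_def matrix_matrix_mult_def sum_over_blocks
      split: sum.split)

lemma stack_matrix_mult: "stack_matrix U1 U2 ** M = stack_matrix (U1 ** M) (U2 ** M)"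
  by (simp add: vec_eq_iff stack_matrix_def matrix_matrix_mult_def split: sum.split)

lemma stack_matrix_vector:
  "(stack_matrix U1 U2 *v x) $ Inl a = (U1 *v x) $ a"
  "(stack_matrix U1 U2 *v x) $ Inr b = (U2 *v x) $ b"
  by (simp_all add: stack_matrix_def matrix_vector_mult_def)

lemma stack_matrix_eq_iff: "stack_matrix U1 U2 = stack_matrix V1 V2 \<longleftrightarrow> U1 = V1 \<and> U2 = V2"
proof
  assume "stack_matrix U1 U2 = stack_matrix V1 V2"
  then have "stack_matrix U1 U2 $ Inl a = stack_matrix V1 V2 $ Inl a"
    "stack_matrix U1 U2 $ Inr b = stack_matrix V1 V2 $ Inr b" for a b by simp_all
  then show "U1 = V1 \<and> U2 = V2" by (simp add: stack_matrix_def vec_eq_iff)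
qed simp

lemma transpose_block_matrix:
  "transpose (block_matrix M11 M12 M21 M22)
    = block_matrix (transpose M11) (transpose M21) (transpose M12) (transpose M22)"
  by (simp add: vec_eq_iff block_matrix_def transpose_def split: sum.split)

lemma graph_matrix_injective: "inj ((*v) (stack_matrix (mat 1) P :: real^'n^('n::finite + 'm::finite)))"
proof (rule injI)
  fix x y assume "stack_matrix (mat 1) P *v x = stack_matrix (mat 1) P *v (y :: real^'n)"
  then have "(stack_matrix (mat 1) P *v x) $ Inl i = (stack_matrix (mat 1) P *v y) $ Inl i" for i
    by simp
  then show "x = y" by (simp add: stack_matrix_vector vec_eq_iff)
qed

text \<open>
  The kernel of the block row \<open>[-P, 1]\<close> is the graph of \<open>P\<close>. The transposed stack encodes this row.
\<close>

lemma range_graph_matrix_if_annihilated: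
  fixes P :: "real^'n^'n"
  assumes "transpose (stack_matrix (- transpose P) (mat 1)) *v z = 0"
  shows "z \<in> range ((*v) (stack_matrix (mat 1) P))"
proof -
  define x where "x = (\<chi> i. z $ Inl i)"
  have "z $ Inr j = (P *v x) $ j" for j
  proof -
    have "(transpose (stack_matrix (- transpose P) (mat 1)) *v z) $ j
        = (\<Sum>i\<in>UNIV. - P $ j $ i * x $ i) + (\<Sum>i\<in>UNIV. mat 1 $ i $ j * z $ Inr i)"
      by (simp add: matrix_vector_mult_def transpose_def stack_matrix_def sum_over_blocks x_def
          del: transpose_matrix_vector)
    also have "(\<Sum>i\<in>UNIV. mat 1 $ i $ j * z $ Inr i) = z $ Inr j"
      by (simp add: mat_def if_distrib if_distribR cong: if_cong)
    finally have "0 = (\<Sum>i\<in>UNIV. - P $ j $ i * x $ i) + z $ Inr j" by (simp only: assms zero_index)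
    then show ?thesis by (simp add: matrix_vector_mult_def sum_negf)
  qed
  then have "z $ k = (stack_matrix (mat 1) P *v x) $ k" for k
    by (cases k) (simp_all add: stack_matrix_vector x_def)
  then have "z = stack_matrix (mat 1) P *v x" by (simp add: vec_eq_iff)
  then show ?thesis by blast
qed

text \<open>
  Let \<open>V\<close> be the block column \<open>[1; P]\<close>, \<open>W\<close> the block row \<open>[-P, 1]\<close> and \<open>M = A - GP\<close>. The Riccati
  equation says that \<open>HV = VM\<close> and \<open>WH = -M\<^sup>T W\<close>. So \<open>H\<close> acts like the stable \<open>M\<close> on the graph of
  \<open>P\<close>, the range of \<open>V\<close> and kernel of \<open>W\<close>, and like the antistable \<open>-M\<^sup>T\<close> modulo this graph. Hence
  \<open>H\<close> has no imaginary eigenvalue, and its stable subspace is the graph.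
\<close>

theorem Dom_Ric_if_stabilizing_solution:
  fixes A G Q P :: "real^'n^'n" and H :: "real^('n + 'n)^('n + 'n)"
  assumes symG: "transpose G = G" and symQ: "transpose Q = Q" and symP: "transpose P = P"
    and ric: "riccati A G Q P = 0" and M: "stable (A - G ** P)"
    and H: "H = block_matrix A (- G) (- Q) (- transpose A)"
  shows "H \<in> Dom_Ric" and "Ric H = P"
proof -
  let ?M = "A - G ** P"
  let ?V = "stack_matrix (mat 1) P"
  let ?W = "transpose (stack_matrix (- P) (mat 1))"
  have PM: "P ** ?M = - Q - transpose A ** P"
    using ric by (simp add: riccati_def matrix_diff_ldistrib matrix_mul_assoc algebra_simps)
  have V: "H ** ?V = ?V ** ?M"
    unfolding H block_matrix_mult_stack stack_matrix_mult stack_matrix_eq_iff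
    by (simp add: PM matrix_mult_uminus_left)
  have "transpose H ** stack_matrix (- P) (mat 1) = stack_matrix (- P) (mat 1) ** (- ?M)"
    unfolding H transpose_block_matrix block_matrix_mult_stack stack_matrix_mult stack_matrix_eq_iff
    by (simp only: matrix_mult_uminus_left matrix_mult_uminus_right matrix_mul_rid matrix_mul_lid
        PM transpose_uminus transpose_transpose symG symQ) simp
  then have "transpose (transpose H ** stack_matrix (- P) (mat 1))
      = transpose (stack_matrix (- P) (mat 1) ** (- ?M))" by simp
  then have W: "(- transpose ?M) ** ?W = ?W ** H"
    by (simp only: matrix_transpose_mul transpose_uminus transpose_transpose)
  have eigM: "Re \<mu> < 0" if "eigenvalue ?M \<mu>" for \<mu> using M that by (simp add: stable_def)
  have eigM': "Re \<mu> > 0" if "eigenvalue (- transpose ?M) \<mu>" for \<mu>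
    using eigM[of "- \<mu>"] that by (simp add: eigenvalue_uminus eigenvalue_transpose)
  have kerW: "z \<in> range ((*v) ?V)" if "?W *v z = 0" for z
    using range_graph_matrix_if_annihilated[of P z] that by (simp only: symP)
  have hyp: "Re \<mu> \<noteq> 0" if eig: "eigenvalue H \<mu>" for \<mu>
  proof -
    obtain x y where xy: "x \<noteq> 0 \<or> y \<noteq> 0"
      and x: "H *v x = Re \<mu> *\<^sub>R x - Im \<mu> *\<^sub>R y" and y: "H *v y = Im \<mu> *\<^sub>R x + Re \<mu> *\<^sub>R y"
      using iffD1[OF eigenvalue_iff_real_parts eig] by (elim exE conjE) (rule that)
    have Wz: "(- transpose ?M) *v (?W *v z) = ?W *v (H *v z)" for z
      by (simp only: matrix_vector_mul_assoc W)
    show ?thesis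
    proof (cases "?W *v x = 0 \<and> ?W *v y = 0")
      case True
      then have "x \<in> range ((*v) ?V)" "y \<in> range ((*v) ?V)"
        by (auto intro!: kerW simp del: transpose_matrix_vector)
      then obtain a b where ab: "x = ?V *v a" "y = ?V *v b" by (elim imageE)
      have Vz: "?V *v (?M *v z) = H *v (?V *v z)" for z
        by (simp only: matrix_vector_mul_assoc V)
      have "?V *v (?M *v a) = ?V *v (Re \<mu> *\<^sub>R a - Im \<mu> *\<^sub>R b)"
        "?V *v (?M *v b) = ?V *v (Im \<mu> *\<^sub>R a + Re \<mu> *\<^sub>R b)"
        unfolding Vz ab[symmetric] x y
        by (simp_all add: ab matrix_vector_mult_diff_distrib matrix_vector_right_distrib
            matrix_vector_mult_scaleR)
      then have "?M *v a = Re \<mu> *\<^sub>R a - Im \<mu> *\<^sub>R b" "?M *v b = Im \<mu> *\<^sub>R a + Re \<mu> *\<^sub>R b"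
        by (simp_all only: inj_eq[OF graph_matrix_injective])
      moreover have "a \<noteq> 0 \<or> b \<noteq> 0" using xy ab by auto
      ultimately have "eigenvalue ?M \<mu>"
        unfolding eigenvalue_iff_real_parts by (intro exI conjI)
      then show ?thesis using eigM by force
    next
      case False
      then have nz: "?W *v x \<noteq> 0 \<or> ?W *v y \<noteq> 0" by simp
      have "(- transpose ?M) *v (?W *v x) = Re \<mu> *\<^sub>R (?W *v x) - Im \<mu> *\<^sub>R (?W *v y)"
        "(- transpose ?M) *v (?W *v y) = Im \<mu> *\<^sub>R (?W *v x) + Re \<mu> *\<^sub>R (?W *v y)"
        unfolding Wz x y
        by (simp_all only: matrix_vector_mult_diff_distrib matrix_vector_right_distrib
            matrix_vector_mult_scaleR)
      with nz have "eigenvalue (- transpose ?M) \<mu>"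
        unfolding eigenvalue_iff_real_parts by (intro exI conjI)
      then show ?thesis using eigM' by force
    qed
  qed
  let ?U = "\<Union>\<mu>\<in>{\<mu>. eigenvalue H \<mu> \<and> Re \<mu> < 0}. generalized_eigenspace H \<mu>"
  have "range ((*v) ?V) \<subseteq> stable_subspace H"
  proof safe
    fix a :: "real^'n"
    have "v \<in> vec.span (\<Union>\<mu>\<in>{\<mu>. eigenvalue ?M \<mu>}. generalized_eigenspace ?M \<mu>)" for v
      by (simp add: generalized_eigenspaces_span)
    then have "complex_matrix ?V *v v \<in> vec.span ?U" for v
    proof (induction v rule: vec.span_induct_alt)
      case base
      show ?case by (simp add: vec.span_zero)
    next
      case (step c v w)
      then obtain \<mu> where \<mu>: "eigenvalue ?M \<mu>" and v: "v \<in> generalized_eigenspace ?M \<mu>" by blast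
      have gen: "complex_matrix ?V *v v \<in> generalized_eigenspace H \<mu>"
        by (rule generalized_eigenspace_intertwining[OF V v])
      have "complex_matrix ?V *v v \<in> vec.span ?U"
      proof (cases "eigenvalue H \<mu>")
        case True
        then show ?thesis using gen eigM[OF \<mu>] by (intro vec.span_base) blast
      next
        case False
        then have "complex_matrix ?V *v v = 0" using generalized_eigenspace_trivial[OF gen] by simp
        then show ?thesis by (simp only: vec.span_zero)
      qed
      then have "c *s (complex_matrix ?V *v v) + complex_matrix ?V *v w \<in> vec.span ?U"
        using step by (intro vec.span_add vec.span_scale) auto
      then show ?case by (simp only: vec.add vec.scale)
    qed
    then show "?V *v a \<in> stable_subspace H"
      unfolding stable_subspace_def mem_Collect_eq complex_matrix_vector[symmetric] .
  qed
  moreover have "stable_subspace H \<subseteq> range ((*v) ?V)"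
  proof
    fix z assume "z \<in> stable_subspace H"
    then have "complex_vector z \<in> vec.span ?U" by (simp add: stable_subspace_def)
    then have "complex_matrix ?W *v complex_vector z = 0"
    proof (induction rule: vec.span_induct_alt)
      case (step c v w)
      then obtain \<mu> where \<mu>: "Re \<mu> < 0" and v: "v \<in> generalized_eigenspace H \<mu>" by blast
      have "\<not> eigenvalue (- transpose ?M) \<mu>" using eigM' \<mu> by force
      then have "complex_matrix ?W *v v = 0"
        using generalized_eigenspace_trivial generalized_eigenspace_intertwining[OF W v] by blast
      then show ?case using step by (simp only: vec.add vec.scale) simp
    qed simp
    then have "?W *v z = 0" unfolding complex_matrix_vector by (simp add: vec_eq_iff)
    then show "z \<in> range ((*v) ?V)" by (rule kerW)
  qed
  ultimately have stab: "stable_subspace H = range ((*v) ?V)" by blast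
  have basis: "stable_basis H (mat 1) P"
    unfolding stable_basis_def stab columns_basis_iff_range[OF graph_matrix_injective] by simp
  have one: "invertible (mat 1 :: real^'n^'n)" by (auto simp: invertible_def intro!: exI[of _ "mat 1"])
  have "hamiltonian_matrix H"
    unfolding hamiltonian_matrix_def H using symG symQ by blast
  then show "H \<in> Dom_Ric" unfolding Dom_Ric_def using hyp basis one by blast
  have inv: "Z ** matrix_inv Z = mat 1" if "invertible Z" for Z :: "real^'n^'n"
    using that someI_ex[of "\<lambda>Z'. Z ** Z' = mat 1 \<and> Z' ** Z = mat 1"]
    by (simp add: invertible_def matrix_inv_def)
  show "Ric H = P"
    unfolding Ric_def
  proof (rule the_equality)
    have "mat 1 ** matrix_inv (mat 1 :: real^'n^'n) = mat 1" by (rule inv[OF one])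
    then have "P = P ** matrix_inv (mat 1)" by simp
    then show "\<exists>U1 U2. stable_basis H U1 U2 \<and> invertible U1 \<and> P = U2 ** matrix_inv U1"
      using basis one by blast
  next
    fix P' assume "\<exists>U1 U2. stable_basis H U1 U2 \<and> invertible U1 \<and> P' = U2 ** matrix_inv U1"
    then obtain U1 U2 where U: "stable_basis H U1 U2" "invertible U1" "P' = U2 ** matrix_inv U1"
      by blast
    have "U2 = P ** U1"
    proof -
      have "U2 $ b $ j = (P ** U1) $ b $ j" for b j
      proof -
        have "column j (stack_matrix U1 U2) \<in> span (columns (stack_matrix U1 U2))"
          by (intro span_base) (auto simp: columns_def)
        also have "\<dots> = range ((*v) ?V)" using U(1) by (simp add: stable_basis_def columns_basis_def stab)
        finally obtain a where a: "column j (stack_matrix U1 U2) = ?V *v a" by blast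
        have "column j (stack_matrix U1 U2) $ Inl i = (?V *v a) $ Inl i"
          "column j (stack_matrix U1 U2) $ Inr i = (?V *v a) $ Inr i" for i
          by (simp_all only: a)
        then have "U1 $ i $ j = a $ i" "U2 $ i $ j = (P *v a) $ i" for i
          by (simp_all only: stack_matrix_vector matrix_vector_mul_lid)
            (simp_all add: column_def stack_matrix_def)
        then show ?thesis by (simp add: matrix_matrix_mult_def matrix_vector_mult_def)
      qed
      then show ?thesis by (simp add: vec_eq_iff)
    qed
    then have "P' = P ** (U1 ** matrix_inv U1)" using U(3) by (simp add: matrix_mul_assoc)
    then show "P' = P" by (simp add: inv[OF U(2)])
  qed
qed

section \<open>Weights below the critical attenuation level\<close>

text \<open>\<open>\<parallel>w\<parallel>\<^sup>2 = \<langle>Nw, y\<rangle>\<close> for \<open>w = N\<^sup>T y\<close>.\<close>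

lemma norm_transpose_mult_le:
  "norm (transpose N *v y) \<le> spectral_norm N * norm (y :: real^'m)"
proof (cases "transpose N *v y = 0")
  case True
  have "0 \<le> spectral_norm N"
    unfolding spectral_norm_def by (rule onorm_pos_le) (simp add: linear_linear)
  then show ?thesis using True by simp
next
  case False
  define w where "w = transpose N *v y"
  have "norm w * norm w = w \<bullet> (transpose N *v y)"
    by (simp add: w_def power2_norm_eq_inner flip: power2_eq_square)
  also have "\<dots> = (N *v w) \<bullet> y" by (rule inner_transpose_mult)
  also have "\<dots> \<le> norm (N *v w) * norm y" by (rule norm_cauchy_schwarz)
  also have "\<dots> \<le> (spectral_norm N * norm w) * norm y"
    unfolding spectral_norm_def by (intro mult_right_mono onorm) (simp_all add: linear_linear)
  finally have "norm w * norm w \<le> norm w * (spectral_norm N * norm y)"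
    by (simp only: mult.left_commute mult.commute)
  then show ?thesis using False by (simp add: w_def)
qed

lemma spectral_norm_transpose_le: "spectral_norm (transpose N) \<le> spectral_norm N"
  unfolding spectral_norm_def[of "transpose N"]
  by (rule onorm_le) (rule norm_transpose_mult_le)

text \<open>
  \<open>\<langle>x, Gx\<rangle> = \<parallel>y\<parallel>\<^sup>2 - \<gamma>\<^sup>-\<^sup>2 \<parallel>N\<^sup>T y\<parallel>\<^sup>2\<close> with \<open>y = B\<^sup>T x\<close>.
\<close>

lemma input_weight_coercive:
  fixes B :: "real^'m^'n" and N :: "real^'k^'m"
  assumes "spectral_norm N < \<gamma>"
    and G: "G = B ** transpose B - inverse (\<gamma>\<^sup>2) *\<^sub>R ((B ** N) ** transpose (B ** N))"
  shows "transpose G = G"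
    and "\<exists>c>0. \<forall>x. c * (norm (transpose B *v x))\<^sup>2 \<le> x \<bullet> (G *v x)"
proof -
  show "transpose G = G" unfolding G by (simp add: matrix_ring_simps)
  let ?s = "spectral_norm N"
  have s: "0 \<le> ?s"
    unfolding spectral_norm_def by (rule onorm_pos_le) (simp add: linear_linear)
  then have \<gamma>: "\<gamma> > 0" using assms(1) by simp
  define c where "c = 1 - ?s\<^sup>2 / \<gamma>\<^sup>2"
  have "?s\<^sup>2 < \<gamma>\<^sup>2" using s assms(1) by (intro power_strict_mono) auto
  then have "c > 0" using \<gamma> by (simp add: c_def)
  moreover have "c * (norm (transpose B *v x))\<^sup>2 \<le> x \<bullet> (G *v x)" for x
  proof -
    define y where "y = transpose B *v x"
    have gram: "x \<bullet> ((Z ** transpose Z) *v x) = (norm (transpose Z *v x))\<^sup>2" for Z :: "real^'l^'n"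
      using inner_gram[of x "transpose Z"] by (simp only: transpose_transpose)
    have "transpose (B ** N) *v x = transpose N *v y"
      by (simp only: y_def matrix_transpose_mul matrix_vector_mul_assoc)
    then have "x \<bullet> (G *v x) = (norm y)\<^sup>2 - inverse (\<gamma>\<^sup>2) * (norm (transpose N *v y))\<^sup>2"
      unfolding G by (simp only: matrix_vector_mult_diff_rdistrib scaleR_matrix_vector_assoc[symmetric]
          inner_diff_right inner_scaleR_right gram y_def)
    moreover have "(norm (transpose N *v y))\<^sup>2 \<le> (?s * norm y)\<^sup>2"
      by (intro power_mono norm_transpose_mult_le) simp
    then have "inverse (\<gamma>\<^sup>2) * (norm (transpose N *v y))\<^sup>2 \<le> inverse (\<gamma>\<^sup>2) * (?s * norm y)\<^sup>2"
      by (intro mult_left_mono) simp_all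
    moreover have "(norm y)\<^sup>2 - inverse (\<gamma>\<^sup>2) * (?s * norm y)\<^sup>2 = c * (norm y)\<^sup>2"
      by (simp add: c_def power_mult_distrib divide_inverse algebra_simps)
    ultimately show ?thesis unfolding y_def[symmetric] by linarith
  qed
  ultimately show "\<exists>c>0. \<forall>x. c * (norm (transpose B *v x))\<^sup>2 \<le> x \<bullet> (G *v x)" by blast
qed

text \<open>
  The control part and its dual, the filtering part, are both instances: \<open>B N\<close> is the projected
  disturbance channel in the former and the transpose of the projected output channel in the latter.
\<close>

theorem hamiltonian_in_Dom_Ric:
  fixes A G :: "real^'n^'n" and B :: "real^'m^'n" and C :: "real^'n^'p" and N :: "real^'k^'m"
  assumes "stabilizable A B" and "detectable C A" and "spectral_norm N < \<gamma>"
    and "G = B ** transpose B - inverse (\<gamma>\<^sup>2) *\<^sub>R ((B ** N) ** transpose (B ** N))"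
    and "H = block_matrix A (- G) (- (transpose C ** C)) (- transpose A)"
  shows "H \<in> Dom_Ric \<and> pos_semidef (Ric H) \<and>
    riccati A G (transpose C ** C) (Ric H) = 0 \<and> stable (A - G ** Ric H)"
proof -
  note G = input_weight_coercive[OF assms(3,4)]
  obtain c where c: "c > 0" "\<And>x. c * (norm (transpose B *v x))\<^sup>2 \<le> x \<bullet> (G *v x)" using G(2) by blast
  obtain P where P: "pos_semidef P" "riccati A G (transpose C ** C) P = 0" "stable (A - G ** P)"
    using stabilizing_riccati_solution_exists[OF assms(1,2) G(1) c] by blast
  have "transpose (transpose C ** C) = transpose C ** C" "transpose P = P"
    using P(1) by (simp_all add: matrix_transpose_mul pos_semidef_def)
  then show ?thesis
    using Dom_Ric_if_stabilizing_solution[OF G(1) _ _ P(2,3) assms(5)] P by simp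
qed

theorem theorem3p2:
  fixes A :: "real^'n^'n"
    and B1o :: "real^'m1^'n" and B2 :: "real^'m2^'n"
    and C1o :: "real^'n^'p1" and C2 :: "real^'n^'p2"
    and B1t :: "real^'m1^'n" and C1t :: "real^'n^'p1"
    and \<gamma> \<gamma>star :: real
    and G H :: "real^'n^'n"
    and Hinf Jinf :: "real^('n + 'n)^('n + 'n)"
    and X Y :: "real^'n^'n"
  assumes B1t: "B1t = B2 ** pinv B2 ** B1o"
    and C1t: "C1t = C1o ** pinv C2 ** C2"
    and \<gamma>star: "\<gamma>star = max (spectral_norm (pinv B2 ** B1o)) (spectral_norm (C1o ** pinv C2))"
    and gt: "\<gamma> > \<gamma>star" and pos: "\<gamma>star > 0"
    and "stabilizable A B2" and "stabilizable A B1t"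
    and "detectable C1t A" and "detectable C2 A"
    and G: "G = B2 ** transpose B2 - inverse (\<gamma>\<^sup>2) *\<^sub>R (B1t ** transpose B1t)"
    and H: "H = transpose C2 ** C2 - inverse (\<gamma>\<^sup>2) *\<^sub>R (transpose C1t ** C1t)"
    and Hinf: "Hinf = block_matrix A (- G) (- (transpose C1t ** C1t)) (- transpose A)"
    and Jinf: "Jinf = block_matrix (transpose A) (- H) (- (B1t ** transpose B1t)) (- A)"
    and X: "X = Ric Hinf" and Y: "Y = Ric Jinf"
  shows "Hinf \<in> Dom_Ric \<and> Jinf \<in> Dom_Ric \<and>
    X = transpose X \<and> pos_semidef X \<and>
    Y = transpose Y \<and> pos_semidef Y \<and>
    transpose A ** X + X ** A - X ** G ** X + transpose C1t ** C1t = 0 \<and>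
    stable (A - G ** X) \<and>
    A ** Y + Y ** transpose A - Y ** H ** Y + B1t ** transpose B1t = 0 \<and>
    stable (transpose A - H ** Y)"
proof -
  have N: "spectral_norm (pinv B2 ** B1o) < \<gamma>" "spectral_norm (transpose (C1o ** pinv C2)) < \<gamma>"
    using gt spectral_norm_transpose_le[of "C1o ** pinv C2"] by (auto simp: \<gamma>star)
  have B1t': "B1t = B2 ** (pinv B2 ** B1o)" by (simp only: B1t matrix_mul_assoc)
  have C1t': "transpose C1t = transpose C2 ** transpose (C1o ** pinv C2)"
    by (simp only: C1t matrix_transpose_mul)
  have "Hinf \<in> Dom_Ric \<and> pos_semidef (Ric Hinf) \<and>
    riccati A G (transpose C1t ** C1t) (Ric Hinf) = 0 \<and> stable (A - G ** Ric Hinf)"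
    by (rule hamiltonian_in_Dom_Ric[OF \<open>stabilizable A B2\<close> \<open>detectable C1t A\<close> N(1) _ Hinf])
      (simp only: G B1t')
  \<comment> \<open>The dual data: transposition exchanges inputs with outputs and stabilizability with
    detectability.\<close>
  moreover have "Jinf \<in> Dom_Ric \<and> pos_semidef (Ric Jinf) \<and>
    riccati (transpose A) H (transpose (transpose B1t) ** transpose B1t) (Ric Jinf) = 0 \<and>
    stable (transpose A - H ** Ric Jinf)"
  proof (rule hamiltonian_in_Dom_Ric[where B = "transpose C2", OF _ _ N(2)])
    show "stabilizable (transpose A) (transpose C2)"
      using \<open>detectable C2 A\<close> by (simp only: detectable_def)
    show "detectable (transpose B1t) (transpose A)"
      using \<open>stabilizable A B1t\<close> by (simp only: detectable_def transpose_transpose)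
    show "H = transpose C2 ** transpose (transpose C2) - inverse (\<gamma>\<^sup>2) *\<^sub>R
        (transpose C2 ** transpose (C1o ** pinv C2) ** transpose (transpose C2 ** transpose (C1o ** pinv C2)))"
      unfolding C1t'[symmetric] by (simp only: H transpose_transpose)
  qed (simp only: Jinf transpose_transpose)
  ultimately show ?thesis
    by (simp add: X Y pos_semidef_def riccati_def)
qed

end
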